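(* Let $\mathbb{K}=\mathbb{R}$ or $\mathbb{C}$ and let $n\ge1$. The interior of a diagospectrahedron is parametrized by a flat totally geodesic space $\mathscr{F}$ in the symmetric space $\mathscr{S}^n_{>0}$, which is of the form $$\mathscr{F}=\exp\tilde{\mathfrak{a}},$$ where $\tilde{\mathfrak{a}}$ is the Cartan subalgebra of $\mathfrak{gl}_n(\mathbb{K})$ given by $\tilde{\mathfrak{a}}=c\cdot Id_n\oplus\mathfrak{a}$, $c\in\mathbb{K}$, and $\mathfrak{a}$ is the set of all trace-zero diagonal matrices with real diagonal entries if $\mathbb{K}=\mathbb{R}$ (respectively, all trace-zero diagonal matrices with diagonal entries of the form $a+\imath b$, $a,b\in\mathbb{R}$, if $\mathbb{K}=\mathbb{C}$).
   Context: A spectrahedron is a set $\{x\in\mathbb{R}^m\mid Q(x)\in\mathscr{S}^n_{\ge0}\}$, where $\mathscr{S}^n_{\ge0}$ is the cone of positive semidefinite symmetric $n\times n$ matrices, $Q(x)=Q_0+\sum_{i=1}^m x_iQ_i$ and the $Q_i$ are symmetric. A diagospectrahedron is a spectrahedron parametrized by diagonal matrices (all $Q_i$ diagonal). Its interior corresponds to the points $x$ for which the diagonal matrix $Q(x)$ is positive definite, and "parametrized by $\mathscr{F}$" means that $\mathscr{F}$ is the space of diagonal matrices of the cone in which these $Q(x)$ lie. The cone $\mathscr{S}^n_{>0}$ of positive definite matrices is regarded as the non-compact symmetric space $GL_n(\mathbb{R})/O_n(\mathbb{R})$ (for $\mathbb{K}=\mathbb{R}$), respectively $GL_n(\mathbb{C})/U_n$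 (for $\mathbb{K}=\mathbb{C}$), with its invariant Riemannian metric (for $\mathbb{K}=\mathbb{R}$, the Hessian of $\ln\chi$, where $\chi(x)=\int_{\mathscr{S}^n_{>0}}e^{-\mathrm{Tr}(xa)}\,da$). Here $\exp$ of a subspace of $\mathfrak{gl}_n(\mathbb{K})$ is understood as its image in this quotient. "Flat" means that the sectional curvature vanishes. The notation $c\cdot Id_n\oplus\mathfrak{a}$ means the set of all $c\,Id_n+A$ with $c\in\mathbb{K}$, $A\in\mathfrak{a}$. *)

theory Defs
  imports "HOL-Analysis.Analysis"
begin

section \<open>The ground field\<close>

text \<open>
  The fields \<open>\<real>\<close> and \<open>\<complex>\<close> with their conjugation. The lemma \<open>real_or_complex_cases\<close> shows
  that the class has no other models.
\<close>

class real_or_complex = real_normed_field + euclidean_space +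
  fixes kcnj :: "'a \<Rightarrow> 'a"
  assumes kcnj_add: "kcnj (x + y) = kcnj x + kcnj y"
    and kcnj_mult: "kcnj (x * y) = kcnj x * kcnj y"
    and mult_kcnj_scaleR: "x * kcnj x = (norm x)\<^sup>2 *\<^sub>R 1"

instantiation real :: real_or_complex
begin
definition kcnj_real :: "real \<Rightarrow> real" where "kcnj_real x = x"
instance by standard (simp_all add: kcnj_real_def power2_eq_square)
end

instantiation complex :: real_or_complex
begin
definition kcnj_complex :: "complex \<Rightarrow> complex" where "kcnj_complex = cnj"
instance
proof
  fix x y :: complex
  show "kcnj (x + y) = kcnj x + kcnj y" "kcnj (x * y) = kcnj x * kcnj y"
    by (simp_all add: kcnj_complex_def)
  show "x * kcnj x = (norm x)\<^sup>2 *\<^sub>R 1"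
    unfolding kcnj_complex_def complex_norm_square[symmetric] scaleR_conv_of_real by simp
qed
end

lemma mult_kcnj: "x * kcnj x = of_real ((norm x)\<^sup>2)"
  using mult_kcnj_scaleR[of x] by (simp only: of_real_def)

lemma kcnj_kcnj: "kcnj (kcnj x) = (x::'a::real_or_complex)"
proof (cases "x = 0")
  case True
  have "kcnj 0 = (0::'a)" using kcnj_add[of "0::'a" 0] by simp
  with True show ?thesis by simp
next
  case False
  have n: "norm (kcnj x) = norm x"
  proof -
    have "norm (x * kcnj x) = (norm x)\<^sup>2" unfolding mult_kcnj norm_of_real by simp
    then show ?thesis using False by (simp add: norm_mult power2_eq_square)
  qed
  have "kcnj x * kcnj (kcnj x) = kcnj x * x"
    using mult_kcnj[of "kcnj x"] mult_kcnj[of x] n by (simp add: mult.commute)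
  moreover have "kcnj x \<noteq> 0" using n False by auto
  ultimately show ?thesis by simp
qed

lemma add_kcnj_Reals: "x + kcnj x \<in> \<real>"
proof -
  have one: "kcnj 1 = (1::'a)" using mult_kcnj[of "1::'a"] by simp
  have "(1 + x) * kcnj (1 + x) = 1 + (x + kcnj x) + x * kcnj x"
    by (simp add: kcnj_add one algebra_simps)
  then have "x + kcnj x = of_real ((norm (1 + x))\<^sup>2 - 1 - (norm x)\<^sup>2)"
    by (simp add: mult_kcnj)
  then show ?thesis by (metis Reals_of_real)
qed

lemma kcnj_0: "kcnj 0 = (0::'a::real_or_complex)"
  using kcnj_add[of "0::'a" 0] by simp

lemma kcnj_of_real: "kcnj (of_real r) = (of_real r :: 'a::real_or_complex)"
proof (cases "r = 0")
  case False
  have "(of_real r :: 'a) * kcnj (of_real r) = of_real r * of_real r"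
    using mult_kcnj[of "of_real r :: 'a"] by (simp add: power2_eq_square flip: of_real_mult)
  with False show ?thesis by simp
qed (simp add: kcnj_0)

lemma kcnj_scaleR: "kcnj (r *\<^sub>R x) = r *\<^sub>R kcnj (x::'a::real_or_complex)"
  by (simp add: scaleR_conv_of_real kcnj_mult kcnj_of_real)

lemma real_or_complex_cases:
  "(\<forall>x::'a::real_or_complex. x \<in> \<real>) \<or>
   (\<exists>i::'a. i * i = - 1 \<and> kcnj i = - i \<and> (\<forall>x. \<exists>a b. x = of_real a + of_real b * i))"
proof (cases "\<forall>x::'a. x \<in> \<real>")
  case False
  then obtain z :: 'a where z: "z \<notin> \<real>" by blast
  define s where "s = z - kcnj z"
  have zero: "kcnj 0 = (0::'a)" using kcnj_add[of "0::'a" 0] by simp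
  have minus: "kcnj (- x) = - kcnj x" for x :: 'a
    using kcnj_add[of x "- x"] zero by (simp add: eq_neg_iff_add_eq_0 add.commute)
  have diff: "kcnj (x - y) = kcnj x - kcnj y" for x y :: 'a
    using kcnj_add[of x "- y"] minus[of y] by simp
  have ks: "kcnj s = - s" by (simp add: s_def diff kcnj_kcnj)
  have half: "(x + kcnj x) / 2 + (x - kcnj x) / 2 = x" for x :: 'a
    by (simp add: field_simps)
  have s0: "s \<noteq> 0"
  proof
    assume "s = 0"
    then have "z = (z + kcnj z) / 2" using half[of z] by (simp add: s_def)
    moreover have "(z + kcnj z) / 2 \<in> \<real>" by (simp add: add_kcnj_Reals Reals_divide)
    ultimately show False using z by simp
  qed
  define i where "i = s / of_real (norm s)"
  have iN: "i = of_real (1 / norm s) * s" by (simp add: i_def)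
  have ki: "kcnj i = - i" unfolding iN by (simp only: kcnj_mult kcnj_of_real ks mult_minus_right)
  have ni: "norm i = 1" using s0 by (simp add: i_def norm_divide)
  have ii: "i * i = - 1" using mult_kcnj[of i] by (simp add: ki ni) (metis minus_minus)
  have "\<exists>a b. x = of_real a + of_real b * i" for x
  proof -
    obtain a where a: "x + kcnj x = of_real a" using add_kcnj_Reals Reals_cases by metis
    define t where "t = x - kcnj x"
    have kt: "kcnj t = - t" by (simp add: t_def diff kcnj_kcnj)
    obtain b where b: "t * i + kcnj (t * i) = of_real b" using add_kcnj_Reals Reals_cases by metis
    then have tb: "2 * (t * i) = of_real b" by (simp add: kcnj_mult kt ki mult.commute)
    have "2 * (t * i) * i = - (2 * t)" using ii by (simp add: mult.assoc)
    then have "2 * t = - (of_real b * i)" using tb by (metis minus_minus)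
    then have t: "t = of_real (- b / 2) * i" by (simp add: field_simps)
    have "x = of_real a / 2 + t / 2" using half[of x] unfolding a t_def by (rule sym)
    also have "\<dots> = of_real (a / 2) + of_real (- b / 4) * i" by (simp add: t)
    finally show ?thesis by blast
  qed
  with ii ki show ?thesis by blast
qed auto

section \<open>Cones of matrices and spectrahedra\<close>

definition ctranspose :: "'k::real_or_complex^'n^'m \<Rightarrow> 'k^'m^'n" where
  "ctranspose A = (\<chi> i j. kcnj (A $ j $ i))"

text \<open>The real vector space of symmetric (for \<open>\<complex>\<close>: Hermitian) matrices.\<close>

definition herm :: "('k::real_or_complex^'n^'n) set" where
  "herm = {A. ctranspose A = A}"

text \<open>
  The inner product of \<open>'k^'n\<close> is the real one, the real part of the sesquilinear form; for
  \<open>A \<in> herm\<close> the form is real at \<open>(v, A v)\<close>, so nothing is lost.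
\<close>

definition psd_cone :: "('k::real_or_complex^'n^'n) set" where
  "psd_cone = {A \<in> herm. \<forall>v. 0 \<le> v \<bullet> (A *v v)}"

definition pos_cone :: "('k::real_or_complex^'n^'n) set" where
  "pos_cone = {A \<in> herm. \<forall>v. v \<noteq> 0 \<longrightarrow> 0 < v \<bullet> (A *v v)}"

definition diagonal_mat :: "'k::zero^'n^'n \<Rightarrow> bool" where
  "diagonal_mat A \<longleftrightarrow> (\<forall>i j. i \<noteq> j \<longrightarrow> A $ i $ j = 0)"

definition pencil ::
  "'k::real_or_complex^'n^'n \<Rightarrow> ('m \<Rightarrow> 'k^'n^'n) \<Rightarrow> real^'m \<Rightarrow> 'k^'n^'n" where
  "pencil Q0 Q x = Q0 + (\<Sum>i\<in>UNIV. (x $ i) *\<^sub>R Q i)"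

definition spectrahedron ::
  "'k::real_or_complex^'n^'n \<Rightarrow> ('m \<Rightarrow> 'k^'n^'n) \<Rightarrow> (real^'m) set" where
  "spectrahedron Q0 Q = {x. pencil Q0 Q x \<in> psd_cone}"

text \<open>
  The interior in the sense of the parametrization: the points whose matrix is positive definite.
  It is the topological interior as soon as it is nonempty (\<open>spectrahedron_interior_eq\<close>); for
  degenerate pencils (such as \<open>Q = 0\<close>) the two can differ.
\<close>

definition spectrahedron_interior ::
  "'k::real_or_complex^'n^'n \<Rightarrow> ('m \<Rightarrow> 'k^'n^'n) \<Rightarrow> (real^'m) set" where
  "spectrahedron_interior Q0 Q = {x. pencil Q0 Q x \<in> pos_cone}"

lemma ctranspose_add: "ctranspose (A + B) = ctranspose A + ctranspose B"
  by (simp add: ctranspose_def vec_eq_iff kcnj_add)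

lemma ctranspose_scaleR: "ctranspose (r *\<^sub>R A) = r *\<^sub>R ctranspose A"
  by (simp add: ctranspose_def vec_eq_iff kcnj_scaleR)

lemma subspace_herm: "subspace herm"
  by (simp add: subspace_def herm_def ctranspose_add ctranspose_scaleR)
     (simp add: ctranspose_def vec_eq_iff kcnj_0)

lemma spectrahedron_interior_eq:
  fixes Q0 :: "'k::real_or_complex^'n^'n" and Q :: "'m::finite \<Rightarrow> 'k^'n^'n"
  assumes herm: "Q0 \<in> herm" "\<And>i. Q i \<in> herm"
    and nonempty: "spectrahedron_interior Q0 Q \<noteq> {}"
  shows "spectrahedron_interior Q0 Q = interior (spectrahedron Q0 Q)"
proof -
  define q where "q x v = v \<bullet> (pencil Q0 Q x *v v)" for x v
  have pherm: "pencil Q0 Q x \<in> herm" for x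
    unfolding pencil_def using herm
    by (intro subspace_add[OF subspace_herm] subspace_sum[OF subspace_herm]
              subspace_scale[OF subspace_herm]) auto
  have inner_form: "v \<bullet> (A *v v) = (\<Sum>i\<in>UNIV. \<Sum>j\<in>UNIV. v $ i \<bullet> (A $ i $ j * v $ j))"
    for v :: "'k^'n" and A :: "'k^'n^'n"
    by (simp add: inner_vec_def matrix_vector_mult_def inner_sum_right)
  have cont: "continuous_on UNIV (\<lambda>(v, x). q x v)"
    unfolding q_def inner_form pencil_def split_beta by (simp, intro continuous_intros)
  have scale: "q x (r *\<^sub>R v) = r\<^sup>2 * q x v" for x r v
    unfolding q_def inner_form by (simp add: sum_distrib_left power2_eq_square mult.assoc)
  have affine: "q ((1 - s) *\<^sub>R y + s *\<^sub>R z) v = (1 - s) * q y v + s * q z v" for s y z v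
  proof -
    have "pencil Q0 Q ((1 - s) *\<^sub>R y + s *\<^sub>R z)
        = (1 - s) *\<^sub>R pencil Q0 Q y + s *\<^sub>R pencil Q0 Q z"
      by (simp add: pencil_def algebra_simps scaleR_sum_right sum.distrib sum_subtractf)
    then show ?thesis
      unfolding q_def inner_form
      by (simp add: sum_distrib_left sum.distrib inner_add_right distrib_right)
  qed
  have pos: "x \<in> spectrahedron_interior Q0 Q \<longleftrightarrow> (\<forall>v\<in>sphere 0 1. 0 < q x v)" for x
  proof
    assume R: "\<forall>v\<in>sphere 0 1. 0 < q x v"
    have "0 < q x v" if "v \<noteq> 0" for v
    proof -
      have "0 < q x ((1 / norm v) *\<^sub>R v)" using R that by simp
      then show ?thesis using that by (simp add: scale zero_less_mult_iff)
    qed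
    then show "x \<in> spectrahedron_interior Q0 Q"
      by (simp add: spectrahedron_interior_def pos_cone_def pherm flip: q_def)
  next
    assume "x \<in> spectrahedron_interior Q0 Q"
    then have q: "v \<noteq> 0 \<Longrightarrow> 0 < q x v" for v
      by (simp add: spectrahedron_interior_def pos_cone_def q_def)
    show "\<forall>v\<in>sphere 0 1. 0 < q x v"
    proof
      fix v :: "'k^'n"
      assume "v \<in> sphere 0 1"
      then have "v \<noteq> 0" by auto
      then show "0 < q x v" by (rule q)
    qed
  qed
  have "closed {x. \<exists>v. v \<in> sphere 0 1 \<and> (v, x) \<in> {(v, x). q x v \<le> 0}}"
  proof (rule closed_compact_projection)
    show "closed {(v, x). q x v \<le> 0}"
      using closed_Collect_le[OF cont, of "\<lambda>_. 0"] by (simp add: case_prod_unfold)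
  qed simp
  moreover have "- spectrahedron_interior Q0 Q
      = {x. \<exists>v. v \<in> sphere 0 1 \<and> (v, x) \<in> {(v, x). q x v \<le> 0}}"
    using pos by (force simp: not_less)
  ultimately have "open (spectrahedron_interior Q0 Q)" by (simp add: open_closed)
  moreover have "spectrahedron_interior Q0 Q \<subseteq> spectrahedron Q0 Q"
  proof -
    have "0 \<le> q x v" if "\<forall>v. v \<noteq> 0 \<longrightarrow> 0 < q x v" for x v
      using that by (cases "v = 0") (auto simp: q_def less_imp_le)
    then show ?thesis
      by (auto simp: spectrahedron_interior_def spectrahedron_def pos_cone_def psd_cone_def
            simp flip: q_def)
  qed
  ultimately have "spectrahedron_interior Q0 Q \<subseteq> interior (spectrahedron Q0 Q)"
    by (rule interior_maximal[rotated])
  moreover have "x \<in> spectrahedron_interior Q0 Q" if x: "x \<in> interior (spectrahedron Q0 Q)" for x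
  proof -
    obtain z where z: "z \<in> spectrahedron_interior Q0 Q" using nonempty by blast
    obtain e where e: "0 < e" "ball x e \<subseteq> spectrahedron Q0 Q" using x mem_interior by blast
    define d where "d = e / (2 * (norm (x - z) + 1))"
    have d0: "0 < d" using e(1) by (simp add: d_def add_nonneg_pos)
    define y where "y = x + d *\<^sub>R (x - z)"
    have "d * norm (x - z) < e"
    proof -
      have "d * norm (x - z) \<le> d * (norm (x - z) + 1)" using d0 by simp
      also have "\<dots> = e / 2"
      proof -
        have "norm (x - z) + 1 \<noteq> 0" using norm_ge_zero[of "x - z"] by linarith
        then show ?thesis unfolding d_def by (simp only: times_divide_eq_left) (simp add: divide_simps)
      qed
      also have "\<dots> < e" using e(1) by simp
      finally show ?thesis .
    qed
    then have "y \<in> spectrahedron Q0 Q" using e d0 by (auto simp: y_def dist_norm intro!: subsetD[OF e(2)])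
    then have y0: "0 \<le> q y v" for v by (simp add: spectrahedron_def psd_cone_def q_def)
    define s where "s = d / (1 + d)"
    have s: "0 < s" "s < 1" using d0 by (auto simp: s_def field_simps)
    have "(1 - s) *\<^sub>R y + s *\<^sub>R z = x"
    proof -
      have 1: "1 - s = 1 / (1 + d)" using d0 by (simp add: s_def field_simps)
      have "(1 + d) *\<^sub>R ((1 - s) *\<^sub>R y + s *\<^sub>R z) = y + d *\<^sub>R z"
        using d0 by (simp add: 1 scaleR_add_right) (simp add: s_def)
      also have "\<dots> = (1 + d) *\<^sub>R x" by (simp add: y_def algebra_simps)
      finally show ?thesis using d0 by simp
    qed
    then have "q x v = (1 - s) * q y v + s * q z v" for v using affine[of s y z v] by simp
    moreover have "0 < q z v" if "v \<in> sphere 0 1" for v using z pos that by blast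
    ultimately show ?thesis using s y0 pos[of x] by (simp add: add_nonneg_pos)
  qed
  ultimately show ?thesis by blast
qed

text \<open>\<open>Q0\<close> and \<open>Q i\<close> are the data of a diagospectrahedron, the set \<open>spectrahedron Q0 Q\<close>.\<close>

definition diagonal_pencil ::
  "'k::real_or_complex^'n^'n \<Rightarrow> ('m \<Rightarrow> 'k^'n^'n) \<Rightarrow> bool" where
  "diagonal_pencil Q0 Q \<longleftrightarrow>
     Q0 \<in> herm \<and> diagonal_mat Q0 \<and> (\<forall>i. Q i \<in> herm \<and> diagonal_mat (Q i))"

definition diag_herm :: "('k::real_or_complex^'n^'n) set" where
  "diag_herm = {A \<in> herm. diagonal_mat A}"

definition diag_cone :: "('k::real_or_complex^'n^'n) set" where
  "diag_cone = {A \<in> pos_cone. diagonal_mat A}"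

section \<open>Riemannian geometry of open subsets of linear spaces\<close>

text \<open>
  Throughout, \<open>M\<close> is a nonempty open subset of a linear subspace \<open>V\<close> of a Euclidean space, so that
  all its tangent spaces are \<open>V\<close>, and \<open>g P X Y\<close> is the metric at \<open>P \<in> M\<close> on tangent vectors
  \<open>X, Y \<in> V\<close>; values of \<open>g\<close> at other arguments are irrelevant.
\<close>

primrec Ck_on ::
  "'a::euclidean_space set \<Rightarrow> 'a set \<Rightarrow> nat \<Rightarrow> ('a \<Rightarrow> real) \<Rightarrow> bool" where
  "Ck_on V M 0 f \<longleftrightarrow> continuous_on M f"
| "Ck_on V M (Suc k) f \<longleftrightarrow>
     (\<exists>f'. (\<forall>P\<in>M. (f has_derivative f' P) (at P within M)) \<and>
           (\<forall>X\<in>V. Ck_on V M k (\<lambda>P. f' P X)))"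

definition riemannian_domain ::
  "'a::euclidean_space set \<Rightarrow> 'a set \<Rightarrow> ('a \<Rightarrow> 'a \<Rightarrow> 'a \<Rightarrow> real) \<Rightarrow> bool" where
  "riemannian_domain V M g \<longleftrightarrow>
     subspace V \<and> openin (top_of_set V) M \<and> M \<noteq> {} \<and>
     (\<forall>P\<in>M.
        (\<forall>X\<in>V. \<forall>Y\<in>V. g P X Y = g P Y X) \<and>
        (\<forall>X\<in>V. \<forall>Y\<in>V. \<forall>Z\<in>V. g P (X + Y) Z = g P X Z + g P Y Z) \<and>
        (\<forall>X\<in>V. \<forall>Y\<in>V. \<forall>r. g P (r *\<^sub>R X) Y = r * g P X Y) \<and>
        (\<forall>X\<in>V. X \<noteq> 0 \<longrightarrow> 0 < g P X X)) \<and>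
     (\<forall>X\<in>V. \<forall>Y\<in>V. \<forall>k. Ck_on V M k (\<lambda>P. g P X Y))"

definition dir_deriv ::
  "('a::real_normed_vector \<Rightarrow> 'b::real_normed_vector) \<Rightarrow> 'a \<Rightarrow> 'a \<Rightarrow> 'b" where
  "dir_deriv f P X = vector_derivative (\<lambda>t. f (P + t *\<^sub>R X)) (at 0)"

text \<open>
  The Levi-Civita connection is \<open>\<nabla>\<^sub>X Y = D\<^sub>X Y + christoffel V g P X Y\<close>, with the Christoffel map
  given by the Koszul formula for constant vector fields.
\<close>

definition christoffel ::
  "'a::euclidean_space set \<Rightarrow> ('a \<Rightarrow> 'a \<Rightarrow> 'a \<Rightarrow> real) \<Rightarrow> 'a \<Rightarrow> 'a \<Rightarrow> 'a \<Rightarrow> 'a" where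
  "christoffel V g P X Y =
     (THE W. W \<in> V \<and> (\<forall>Z\<in>V.
        2 * g P W Z = dir_deriv (\<lambda>R. g R Y Z) P X + dir_deriv (\<lambda>R. g R X Z) P Y
                      - dir_deriv (\<lambda>R. g R X Y) P Z))"

text \<open>\<open>R(X,Y)Z\<close> with the sign convention \<open>R(X,Y) = [\<nabla>\<^sub>X, \<nabla>\<^sub>Y] - \<nabla>\<^bsub>[X,Y]\<^esub>\<close>.\<close>

definition curvature ::
  "'a::euclidean_space set \<Rightarrow> ('a \<Rightarrow> 'a \<Rightarrow> 'a \<Rightarrow> real) \<Rightarrow> 'a \<Rightarrow> 'a \<Rightarrow> 'a \<Rightarrow> 'a \<Rightarrow> 'a" where
  "curvature V g P X Y Z =
     dir_deriv (\<lambda>R. christoffel V g R Y Z) P X - dir_deriv (\<lambda>R. christoffel V g R X Z) P Y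
     + christoffel V g P X (christoffel V g P Y Z) - christoffel V g P Y (christoffel V g P X Z)"

definition sectional_curvature ::
  "'a::euclidean_space set \<Rightarrow> ('a \<Rightarrow> 'a \<Rightarrow> 'a \<Rightarrow> real) \<Rightarrow> 'a \<Rightarrow> 'a \<Rightarrow> 'a \<Rightarrow> real" where
  "sectional_curvature V g P X Y =
     g P (curvature V g P X Y Y) X / (g P X X * g P Y Y - (g P X Y)\<^sup>2)"

definition flat ::
  "'a::euclidean_space set \<Rightarrow> 'a set \<Rightarrow> ('a \<Rightarrow> 'a \<Rightarrow> 'a \<Rightarrow> real) \<Rightarrow> bool" where
  "flat V M g \<longleftrightarrow>
     (\<forall>P\<in>M. \<forall>X\<in>V. \<forall>Y\<in>V. X \<noteq> Y \<and> independent {X, Y} \<longrightarrow> sectional_curvature V g P X Y = 0)"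

definition geodesic ::
  "'a::euclidean_space set \<Rightarrow> 'a set \<Rightarrow> ('a \<Rightarrow> 'a \<Rightarrow> 'a \<Rightarrow> real) \<Rightarrow> real set \<Rightarrow> (real \<Rightarrow> 'a) \<Rightarrow> bool"
  where
  "geodesic V M g I \<gamma> \<longleftrightarrow> open I \<and> is_interval I \<and>
     (\<exists>\<gamma>' \<gamma>''. \<forall>t\<in>I. \<gamma> t \<in> M \<and>
        (\<gamma> has_vector_derivative \<gamma>' t) (at t) \<and> (\<gamma>' has_vector_derivative \<gamma>'' t) (at t) \<and>
        \<gamma>'' t + christoffel V g (\<gamma> t) (\<gamma>' t) (\<gamma>' t) = 0)"

text \<open>
  \<open>F\<close>, an open subset of the subspace \<open>W\<close> of \<open>V\<close>, is a submanifold of \<open>M\<close> with all tangent spaces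
  equal to \<open>W\<close> and with the induced metric, which is again \<open>g\<close>. It is totally geodesic if its
  geodesics are geodesics of the ambient space.
\<close>

definition totally_geodesic ::
  "'a::euclidean_space set \<Rightarrow> 'a set \<Rightarrow> ('a \<Rightarrow> 'a \<Rightarrow> 'a \<Rightarrow> real) \<Rightarrow> 'a set \<Rightarrow> 'a set \<Rightarrow> bool" where
  "totally_geodesic V M g W F \<longleftrightarrow>
     riemannian_domain V M g \<and> riemannian_domain W F g \<and> W \<subseteq> V \<and> F \<subseteq> M \<and>
     (\<forall>I \<gamma>. geodesic W F g I \<gamma> \<longrightarrow> geodesic V M g I \<gamma>)"

section \<open>The symmetric space of positive definite matrices\<close>

text \<open>
  The quotient of the general linear group by the orthogonal (unitary) group is identified with
  \<open>pos_cone\<close> as the orbit of the identity under \<open>P \<mapsto> a P a\<^sup>*\<close> (see \<open>gl_quotient_map_eq_iff\<close>). Invariant metrics are not unique: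
  besides a scale, the centre of the group can be rescaled separately. On real symmetric matrices
  the Hessian of the logarithm of the Koszul-Vinberg characteristic function of the cone is one
  of them, namely \<open>(n + 1) / 2\<close> times the trace of \<open>P\<^sup>-\<^sup>1 X P\<^sup>-\<^sup>1 Y\<close>.
\<close>

definition congruence :: "'k::real_or_complex^'n^'n \<Rightarrow> 'k^'n^'n \<Rightarrow> 'k^'n^'n" where
  "congruence a P = a ** P ** ctranspose a"

definition invariant_metric ::
  "('k::real_or_complex^'n^'n \<Rightarrow> 'k^'n^'n \<Rightarrow> 'k^'n^'n \<Rightarrow> real) \<Rightarrow> bool" where
  "invariant_metric g \<longleftrightarrow>
     riemannian_domain herm pos_cone g \<and>
     (\<forall>a. invertible a \<longrightarrow> (\<forall>P\<in>pos_cone. \<forall>X\<in>herm. \<forall>Y\<in>herm.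
        g (congruence a P) (congruence a X) (congruence a Y) = g P X Y))"

definition gl_quotient_map :: "'k::real_or_complex^'n^'n \<Rightarrow> 'k^'n^'n" where
  "gl_quotient_map a = congruence a (mat 1)"

lemma kcnj_sum: "kcnj (sum f S) = (\<Sum>i\<in>S. kcnj (f i :: 'a::real_or_complex))"
  by (induction S rule: infinite_finite_induct) (simp_all add: kcnj_0 kcnj_add)

lemma ctranspose_mult: "ctranspose (A ** B) = ctranspose B ** ctranspose A"
  by (simp add: ctranspose_def matrix_matrix_mult_def vec_eq_iff kcnj_mult kcnj_sum mult.commute)

lemma ctranspose_1: "ctranspose (mat 1) = mat 1"
  using kcnj_of_real[of 1] by (simp add: ctranspose_def mat_def vec_eq_iff kcnj_0)

lemma gl_quotient_map_eq_iff:
  fixes a b :: "'k::real_or_complex^'n^'n"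
  assumes "invertible b"
  shows "gl_quotient_map a = gl_quotient_map b \<longleftrightarrow> (\<exists>u. u ** ctranspose u = mat 1 \<and> a = b ** u)"
proof
  assume eq: "gl_quotient_map a = gl_quotient_map b"
  obtain b' where b': "b ** b' = mat 1" "b' ** b = mat 1" using assms invertible_def by blast
  have "(b' ** a) ** ctranspose (b' ** a) = b' ** (a ** ctranspose a) ** ctranspose b'"
    by (simp add: ctranspose_mult matrix_mul_assoc)
  also have "\<dots> = (b' ** b) ** ctranspose (b' ** b)"
    using eq by (simp add: gl_quotient_map_def congruence_def ctranspose_mult matrix_mul_assoc)
  also have "\<dots> = mat 1" by (simp add: b' ctranspose_1)
  finally have "(b' ** a) ** ctranspose (b' ** a) = mat 1" .
  moreover have "a = b ** (b' ** a)" by (simp add: matrix_mul_assoc b')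
  ultimately show "\<exists>u. u ** ctranspose u = mat 1 \<and> a = b ** u" by blast
next
  assume "\<exists>u. u ** ctranspose u = mat 1 \<and> a = b ** u"
  then obtain u where u: "u ** ctranspose u = mat 1" "a = b ** u" by blast
  have "a ** ctranspose a = b ** (u ** ctranspose u) ** ctranspose b"
    by (simp only: u(2) ctranspose_mult matrix_mul_assoc)
  then show "gl_quotient_map a = gl_quotient_map b" by (simp add: u gl_quotient_map_def congruence_def)
qed

text \<open>The product \<open>*\<close> of \<open>'k^'n^'n\<close> is componentwise, so \<open>exp\<close> is not the matrix exponential.\<close>

definition matrix_exp :: "'k::real_or_complex^'n^'n \<Rightarrow> 'k^'n^'n" where
  "matrix_exp A = (\<Sum>k. (1 / fact k) *\<^sub>R (((**) A ^^ k) (mat 1)))"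

section \<open>Cartan subalgebras of the general linear Lie algebra\<close>

definition lie_bracket :: "'k::real_or_complex^'n^'n \<Rightarrow> 'k^'n^'n \<Rightarrow> 'k^'n^'n" where
  "lie_bracket A B = A ** B - B ** A"

definition K_subspace :: "('k::real_or_complex^'n^'n) set \<Rightarrow> bool" where
  "K_subspace S \<longleftrightarrow> 0 \<in> S \<and> (\<forall>A\<in>S. \<forall>B\<in>S. A + B \<in> S) \<and> (\<forall>c. \<forall>A\<in>S. mat c ** A \<in> S)"

definition lie_subalgebra :: "('k::real_or_complex^'n^'n) set \<Rightarrow> bool" where
  "lie_subalgebra h \<longleftrightarrow> K_subspace h \<and> (\<forall>A\<in>h. \<forall>B\<in>h. lie_bracket A B \<in> h)"

primrec lower_central :: "('k::real_or_complex^'n^'n) set \<Rightarrow> nat \<Rightarrow> ('k^'n^'n) set" where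
  "lower_central h 0 = h"
| "lower_central h (Suc k) =
     K_subspace hull {lie_bracket A B | A B. A \<in> h \<and> B \<in> lower_central h k}"

definition cartan_subalgebra :: "('k::real_or_complex^'n^'n) set \<Rightarrow> bool" where
  "cartan_subalgebra h \<longleftrightarrow>
     lie_subalgebra h \<and> (\<exists>k. lower_central h k = {0}) \<and>
     {A. \<forall>B\<in>h. lie_bracket A B \<in> h} = h"

definition trace_zero_diag :: "('k::real_or_complex^'n^'n) set" where
  "trace_zero_diag = {A. diagonal_mat A \<and> trace A = 0}"

definition a_tilde :: "('k::real_or_complex^'n^'n) set" where
  "a_tilde = {mat c + A | c A. A \<in> trace_zero_diag}"

end

theory Submission
  imports Defs
begin

text \<open>
  The diagonal matrices of the cone are the orbit of the identity under congruence by invertible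
  real diagonal matrices, and two groups of such congruences, both isometries, do all the work.

  Congruences by positive diagonal matrices act simply transitively on the diagonal cone, so in the coordinates
  \<open>ln p\<^sub>i\<close> the metric restricted to it has constant coefficients (\<open>metric_rdiag\<close>). In
  the linear coordinates \<open>p\<^sub>i\<close> its Christoffel map is therefore
  \<open>\<Gamma>\<^sub>p(x, y) = - x y / p\<close>, componentwise, whatever the constants are, and the
  curvature vanishes because \<open>x y z / p\<^sup>2\<close> is symmetric in \<open>x, y, z\<close>.

  Sign changes \<open>P \<mapsto> s P s\<close> with \<open>s\<close> diagonal and \<open>s\<^sup>2 = 1\<close> fix exactly the
  diagonal matrices when all of them are taken together, and the fixed points of a group of
  isometries are totally geodesic. In terms of the Koszul formula: its two sides, as functionals of
  the test vector \<open>Z\<close>, are invariant under sign changes and hence depend only on the diagonal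
  part of \<open>Z\<close> (\<open>sign_invariant_functional\<close>). The formula valid for diagonal \<open>Z\<close> thus holds for
  all Hermitian \<open>Z\<close> (\<open>koszul_rdiag\<close>), so the ambient Christoffel map restricts to that of
  the diagonal cone and the two geodesic equations coincide there.

  The algebraic statements are computations with diagonal entries: \<open>a_tilde\<close> is the space of all
  diagonal matrices, which is abelian and self-normalizing since the bracket of \<open>A\<close> with
  \<open>diag d\<close> has entries \<open>(d\<^sub>j - d\<^sub>i) A\<^sub>i\<^sub>j\<close>; and \<open>exp (diag d)\<close> is sent to the matrix
  with diagonal entries \<open>\<bar>exp d\<^sub>i\<bar>\<^sup>2\<close>, which take all positive values.
\<close>

section \<open>Diagonal matrices\<close>

definition kdiag :: "('n \<Rightarrow> 'k) \<Rightarrow> 'k::real_or_complex^'n^'n" where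
  "kdiag d = (\<chi> i j. if i = j then d i else 0)"

text \<open>
  A constant of its own, so that rewriting keeps the real entries visible and does not distribute
  \<open>of_real\<close> over them.
\<close>

definition rdiag :: "('n \<Rightarrow> real) \<Rightarrow> 'k::real_or_complex^'n^'n" where
  "rdiag x = kdiag (\<lambda>i. of_real (x i))"

lemma kdiag_nth: "kdiag d $ i $ j = (if i = j then d i else 0)"
  by (simp add: kdiag_def)

lemma rdiag_nth: "rdiag x $ i $ j = (if i = j then of_real (x i) else 0)"
  by (simp add: rdiag_def kdiag_nth)

lemma kdiag_eq_iff: "kdiag d = kdiag e \<longleftrightarrow> d = e"
  by (auto simp: vec_eq_iff kdiag_nth fun_eq_iff)

lemma diagonal_mat_iff: "diagonal_mat A \<longleftrightarrow> A \<in> range kdiag"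
proof
  assume "diagonal_mat A"
  then show "A \<in> range kdiag"
    by (intro range_eqI[of _ _ "\<lambda>i. A $ i $ i"]) (simp add: diagonal_mat_def vec_eq_iff kdiag_nth)
qed (auto simp: diagonal_mat_def kdiag_nth)

lemma mat_eq_kdiag: "mat c = kdiag (\<lambda>_. c)"
  by (auto simp: mat_def vec_eq_iff kdiag_nth)

lemma kdiag_mult_nth: "(kdiag d ** A) $ i $ j = d i * A $ i $ j"
proof -
  have "(kdiag d ** A) $ i $ j = (\<Sum>k\<in>UNIV. if k = i then d i * A $ i $ j else 0)"
    unfolding matrix_matrix_mult_def kdiag_nth vec_lambda_beta by (rule sum.cong) auto
  then show ?thesis by simp
qed

lemma mult_kdiag_nth: "(A ** kdiag d) $ i $ j = A $ i $ j * d j"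
proof -
  have "(A ** kdiag d) $ i $ j = (\<Sum>k\<in>UNIV. if k = j then A $ i $ j * d j else 0)"
    unfolding matrix_matrix_mult_def kdiag_nth vec_lambda_beta by (rule sum.cong) auto
  then show ?thesis by simp
qed

lemma kdiag_mult: "kdiag d ** kdiag e = kdiag (\<lambda>i. d i * e i)"
  by (auto simp: vec_eq_iff kdiag_mult_nth kdiag_nth)

lemma ctranspose_kdiag: "ctranspose (kdiag d) = kdiag (\<lambda>i. kcnj (d i))"
  by (auto simp: vec_eq_iff ctranspose_def kdiag_nth kcnj_0)

lemma congruence_rdiag_nth:
  "congruence (rdiag a) Z $ i $ j = (a i * a j) *\<^sub>R (Z $ i $ j)"
  by (simp add: congruence_def rdiag_def ctranspose_kdiag kcnj_of_real mult_kdiag_nth kdiag_mult_nth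
      scaleR_conv_of_real mult_ac)

lemma congruence_rdiag: "congruence (rdiag a) (rdiag p) = rdiag (\<lambda>i. (a i)\<^sup>2 * p i)"
  by (auto simp: vec_eq_iff congruence_rdiag_nth rdiag_nth scaleR_conv_of_real power2_eq_square)

lemma invertible_rdiag:
  assumes "\<And>i. a i \<noteq> 0"
  shows "invertible (rdiag a)"
  unfolding invertible_def
  by (rule exI[of _ "rdiag (\<lambda>i. 1 / a i)"])
     (simp add: rdiag_def kdiag_mult mat_eq_kdiag kdiag_eq_iff assms)

lemma rdiag_add: "rdiag x + rdiag y = rdiag (\<lambda>i. x i + y i)"
  by (simp add: vec_eq_iff rdiag_nth)

lemma rdiag_scaleR: "r *\<^sub>R rdiag x = rdiag (\<lambda>i. r * x i)"
  unfolding vec_eq_iff vector_scaleR_component rdiag_nth by (simp add: scaleR_conv_of_real)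

lemma rdiag_sum_units:
  fixes x :: "'n::finite \<Rightarrow> real"
  shows "(rdiag x :: 'k::real_or_complex^'n^'n)
    = (\<Sum>i\<in>UNIV. x i *\<^sub>R rdiag (\<lambda>j. if j = i then 1 else 0))"
proof -
  have "(\<Sum>k\<in>UNIV. x k *\<^sub>R (rdiag (\<lambda>j. if j = k then 1 else 0) :: 'k^'n^'n) $ i $ j)
      = (\<Sum>k\<in>UNIV. if k = i then (rdiag x :: 'k^'n^'n) $ i $ j else 0)" for i j
    by (rule sum.cong) (simp_all add: rdiag_nth scaleR_conv_of_real)
  then show ?thesis by (simp add: vec_eq_iff)
qed

text \<open>
  A diagonal entry of a Hermitian matrix equals its conjugate, and twice it is then a sum
  \<open>d + kcnj d\<close>, which is real over both fields.
\<close>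

lemma diag_herm_eq: "diag_herm = range rdiag"
proof (intro set_eqI iffI)
  fix A :: "'k::real_or_complex^'n^'n"
  assume "A \<in> diag_herm"
  then have "A \<in> range kdiag" and h: "ctranspose A = A"
    by (simp_all add: diag_herm_def herm_def diagonal_mat_iff)
  then obtain d where A: "A = kdiag d" by blast
  have "(\<lambda>i. kcnj (d i)) = d"
    using h unfolding A ctranspose_kdiag kdiag_eq_iff .
  then have fixed: "kcnj (d i) = d i" for i by (rule fun_cong)
  have "\<exists>r. d i = of_real r" for i
  proof -
    have "2 * d i \<in> \<real>" using add_kcnj_Reals[of "d i"] unfolding fixed mult_2 .
    then have "2 * d i / 2 \<in> \<real>" by (intro Reals_divide) auto
    then show ?thesis by (auto elim: Reals_cases)
  qed
  then obtain x where "\<And>i. d i = of_real (x i)" by metis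
  then have "A = rdiag x" by (simp add: A rdiag_def kdiag_eq_iff fun_eq_iff)
  then show "A \<in> range rdiag" by blast
next
  fix A :: "'k::real_or_complex^'n^'n"
  assume "A \<in> range rdiag"
  then show "A \<in> diag_herm"
    by (auto simp: diag_herm_def herm_def rdiag_def ctranspose_kdiag kcnj_of_real diagonal_mat_iff)
qed

lemma rdiag_quadratic_form:
  "v \<bullet> (rdiag x *v v) = (\<Sum>i\<in>UNIV. x i * (norm (v $ i))\<^sup>2)"
proof -
  have "(rdiag x *v v) $ i = x i *\<^sub>R v $ i" for i
  proof -
    have "(rdiag x *v v) $ i = (\<Sum>k\<in>UNIV. if k = i then of_real (x i) * v $ i else 0)"
      unfolding matrix_vector_mult_def rdiag_nth vec_lambda_beta by (rule sum.cong) auto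
    then show ?thesis by (simp add: scaleR_conv_of_real)
  qed
  then show ?thesis by (simp add: inner_vec_def power2_norm_eq_inner)
qed

lemma rdiag_in_pos_cone_iff:
  fixes x :: "'n::finite \<Rightarrow> real"
  shows "(rdiag x :: 'k::real_or_complex^'n^'n) \<in> pos_cone \<longleftrightarrow> (\<forall>i. 0 < x i)"
proof
  assume A: "(rdiag x :: 'k^'n^'n) \<in> pos_cone"
  show "\<forall>i. 0 < x i"
  proof
    fix i
    have "0 < axis i (1::'k) \<bullet> (rdiag x *v axis i 1)"
      using A by (auto simp: pos_cone_def)
    also have "\<dots> = (\<Sum>j\<in>UNIV. if j = i then x i else 0)"
      unfolding rdiag_quadratic_form by (rule sum.cong) (auto simp: axis_def)
    finally show "0 < x i" by simp
  qed
next
  assume x: "\<forall>i. 0 < x i"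
  have "0 < v \<bullet> (rdiag x *v v)" if "v \<noteq> 0" for v :: "'k^'n"
  proof -
    obtain i where "v $ i \<noteq> 0" using \<open>v \<noteq> 0\<close> by (auto simp: vec_eq_iff)
    then show ?thesis unfolding rdiag_quadratic_form
      using x by (intro sum_pos2[of _ i]) (auto simp: less_imp_le)
  qed
  moreover have "(rdiag x :: 'k^'n^'n) \<in> diag_herm" by (simp add: diag_herm_eq)
  ultimately show "(rdiag x :: 'k^'n^'n) \<in> pos_cone"
    by (simp add: pos_cone_def diag_herm_def)
qed

lemma diag_cone_eq_Int: "diag_cone = diag_herm \<inter> pos_cone"
  by (auto simp: diag_cone_def diag_herm_def pos_cone_def)

lemma diag_cone_eq: "diag_cone = rdiag ` {p. \<forall>i. 0 < p i}"
  unfolding diag_cone_eq_Int diag_herm_eq by (auto simp: rdiag_in_pos_cone_iff)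

section \<open>The Cartan subalgebra of diagonal matrices\<close>

text \<open>
  Subtracting the scalar matrix \<open>trace D / n\<close> makes the trace vanish; the division is possible
  because the field has characteristic zero.
\<close>

lemma a_tilde_eq: "a_tilde = (range kdiag :: ('k::real_or_complex^'n^'n) set)"
proof -
  have "\<exists>c A. D = mat c + A \<and> diagonal_mat A \<and> trace A = 0" if D: "diagonal_mat D" for D :: "'k^'n^'n"
  proof (intro exI conjI)
    define c where "c = trace D / of_nat CARD('n)"
    show "D = mat c + (D - mat c)" by simp
    show "diagonal_mat (D - mat c)" using D by (simp add: diagonal_mat_def mat_def)
    show "trace (D - mat c) = 0" by (simp add: trace_sub) (simp add: trace_def mat_def c_def)
  qed
  moreover have "diagonal_mat (mat c + A)" if "diagonal_mat A" for c and A :: "'k^'n^'n"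
    using that by (simp add: diagonal_mat_def mat_def)
  ultimately show ?thesis
    unfolding a_tilde_def trace_zero_diag_def set_eq_iff mem_Collect_eq diagonal_mat_iff[symmetric]
    by metis
qed

lemma K_subspace_0: "K_subspace {0}"
  by (simp add: K_subspace_def matrix_matrix_mult_def vec_eq_iff)

lemma lie_bracket_kdiag: "lie_bracket (kdiag d) (kdiag e) = 0"
  by (simp add: lie_bracket_def kdiag_mult mult.commute)

lemma lie_bracket_nth_kdiag: "lie_bracket A (kdiag d) $ i $ j = (d j - d i) * A $ i $ j"
  by (simp add: lie_bracket_def kdiag_mult_nth mult_kdiag_nth algebra_simps)

text \<open>
  If \<open>A\<close> normalizes the diagonal matrices, its bracket with the \<open>j\<close>-th matrix unit on the diagonal
  is diagonal, but has the entry \<open>A\<^sub>i\<^sub>j\<close> at \<open>(i, j)\<close> for \<open>i \<noteq> j\<close>; so \<open>A\<close> is diagonal.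
\<close>

lemma cartan_subalgebra_range_kdiag:
  "cartan_subalgebra (range kdiag :: ('k::real_or_complex^'n^'n) set)"
  unfolding cartan_subalgebra_def
proof (intro conjI)
  have zero: "(0 :: 'k^'n^'n) = kdiag (\<lambda>_. 0)" by (simp add: vec_eq_iff kdiag_nth)
  have "kdiag d + kdiag e \<in> range kdiag" for d e :: "'n \<Rightarrow> 'k"
    by (rule range_eqI[of _ _ "\<lambda>i. d i + e i"]) (simp add: vec_eq_iff kdiag_nth)
  then show alg: "lie_subalgebra (range kdiag :: ('k^'n^'n) set)"
    unfolding lie_subalgebra_def K_subspace_def
    by (auto simp: zero mat_eq_kdiag kdiag_mult lie_bracket_kdiag)
  have "lie_bracket (kdiag (\<lambda>_. 0)) (kdiag (\<lambda>_. 0)) = (0 :: 'k^'n^'n)"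
    by (rule lie_bracket_kdiag)
  then have "{lie_bracket A B | A B. A \<in> range kdiag \<and> B \<in> range kdiag} = {0 :: 'k^'n^'n}"
    unfolding set_eq_iff by (force simp: lie_bracket_kdiag)
  then have "lower_central (range kdiag) (Suc 0) = {0 :: 'k^'n^'n}"
    by (simp add: hull_same K_subspace_0)
  then show "\<exists>k. lower_central (range kdiag) k = {0 :: 'k^'n^'n}" by blast
  show "{A. \<forall>B\<in>range kdiag. lie_bracket A B \<in> range kdiag} = (range kdiag :: ('k^'n^'n) set)"
  proof (intro set_eqI iffI)
    fix A :: "'k^'n^'n"
    assume A: "A \<in> {A. \<forall>B\<in>range kdiag. lie_bracket A B \<in> range kdiag}"
    have "A $ i $ j = 0" if "i \<noteq> j" for i j
    proof -
      have "lie_bracket A (kdiag (\<lambda>k. if k = j then 1 else 0)) \<in> range kdiag" using A by blast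
      then have "lie_bracket A (kdiag (\<lambda>k. if k = j then 1 else 0)) $ i $ j = 0"
        using that by (auto simp: kdiag_nth)
      then show ?thesis using that by (simp add: lie_bracket_nth_kdiag)
    qed
    then have "diagonal_mat A" by (simp add: diagonal_mat_def)
    then show "A \<in> range kdiag" by (simp add: diagonal_mat_iff)
  next
    fix A :: "'k^'n^'n"
    assume "A \<in> range kdiag"
    then show "A \<in> {A. \<forall>B\<in>range kdiag. lie_bracket A B \<in> range kdiag}"
      using alg by (auto simp: lie_subalgebra_def)
  qed
qed

section \<open>The exponential of diagonal matrices\<close>

lemma matrix_exp_kdiag:
  fixes d :: "'n::finite \<Rightarrow> 'k::real_or_complex"
  shows "matrix_exp (kdiag d) = kdiag (\<lambda>i. exp (d i))"
proof -
  have pow: "((**) (kdiag d) ^^ k) (mat 1) = kdiag (\<lambda>i. d i ^ k)" for k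
    by (induction k) (simp_all add: mat_eq_kdiag kdiag_mult)
  have "(\<lambda>k. (1 / fact k) *\<^sub>R kdiag (\<lambda>i. d i ^ k)) sums kdiag (\<lambda>i. exp (d i))"
    unfolding sums_def
  proof (intro vec_tendstoI)
    fix i j
    have "(\<lambda>n. \<Sum>k<n. (1 / fact k) *\<^sub>R d i ^ k) \<longlonglongrightarrow> exp (d i)"
      using exp_converges[of "d i"] by (simp add: sums_def inverse_eq_divide)
    then show "(\<lambda>n. (\<Sum>k<n. (1 / fact k) *\<^sub>R kdiag (\<lambda>i. d i ^ k)) $ i $ j)
        \<longlonglongrightarrow> kdiag (\<lambda>i. exp (d i)) $ i $ j"
      by (cases "i = j") (simp_all add: kdiag_nth)
  qed
  then show ?thesis by (simp add: matrix_exp_def pow sums_iff)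
qed

lemma gl_quotient_map_exp_kdiag:
  "gl_quotient_map (matrix_exp (kdiag d)) = rdiag (\<lambda>i. (norm (exp (d i)))\<^sup>2)"
  by (simp add: matrix_exp_kdiag rdiag_def gl_quotient_map_def congruence_def ctranspose_kdiag
      kdiag_mult mult_kcnj mat_eq_kdiag)

lemma diag_cone_eq_exp:
  "diag_cone = (\<lambda>A. gl_quotient_map (matrix_exp A)) ` (range kdiag :: ('k::real_or_complex^'n^'n) set)"
proof -
  have "rdiag p \<in> range (\<lambda>d. rdiag (\<lambda>i. (norm (exp (d i :: 'k)))\<^sup>2) :: 'k^'n^'n)"
    if p: "\<forall>i. 0 < p i" for p :: "'n \<Rightarrow> real"
  proof (rule range_eqI)
    (* The quotient map doubles a Hermitian exponent, so half of ln p is the logarithm needed;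
       over the complex numbers, adding a purely imaginary diagonal matrix gives the same point. *)
    have "(norm (exp (of_real (ln (p i) / 2) :: 'k)))\<^sup>2 = p i" for i
    proof -
      have "(norm (exp (of_real (ln (p i) / 2) :: 'k)))\<^sup>2 = (exp (ln (p i) / 2))\<^sup>2"
        by (simp add: exp_of_real norm_of_real del: of_real_divide)
      also have "\<dots> = p i" using p by (simp flip: exp_double)
      finally show ?thesis .
    qed
    then show "rdiag p = rdiag (\<lambda>i. (norm (exp (of_real (ln (p i) / 2) :: 'k)))\<^sup>2)" by simp
  qed
  moreover have "rdiag (\<lambda>i. (norm (exp (d i)))\<^sup>2) \<in> rdiag ` {p. \<forall>i. 0 < p i}" for d :: "'n \<Rightarrow> 'k"
    by (rule imageI) simp
  ultimately show ?thesis
    unfolding diag_cone_eq image_image gl_quotient_map_exp_kdiag by blast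
qed

section \<open>Calculus on open subsets of subspaces\<close>

lemma eventually_line_in_openin:
  fixes P X :: "'a::euclidean_space"
  assumes "subspace V" "openin (top_of_set V) M" "P \<in> M" "X \<in> V"
  shows "\<forall>\<^sub>F t in nhds 0. P + t *\<^sub>R X \<in> M"
proof -
  obtain T where T: "open T" "M = V \<inter> T" using assms(2) openin_open by blast
  have "continuous_on UNIV (\<lambda>t. P + t *\<^sub>R X)" by (intro continuous_intros)
  then have "open ((\<lambda>t. P + t *\<^sub>R X) -` T)" using T(1) open_vimage by blast
  moreover have "0 \<in> (\<lambda>t. P + t *\<^sub>R X) -` T" using T assms(3) by simp
  moreover have "P + t *\<^sub>R X \<in> V" for t
    using T assms by (auto intro: subspace_add subspace_scale)
  ultimately show ?thesis unfolding eventually_nhds T(2) by blast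
qed

lemma dir_deriv_cong:
  assumes "\<forall>\<^sub>F t in nhds 0. f (P + t *\<^sub>R X) = h (P' + t *\<^sub>R X')"
  shows "dir_deriv f P X = dir_deriv h P' X'"
  unfolding dir_deriv_def
  by (rule vector_derivative_cong_eq) (use assms in auto)

lemma dir_deriv_eqI:
  assumes "\<forall>\<^sub>F t in nhds 0. f (P + t *\<^sub>R X) = h t" and "(h has_vector_derivative D) (at 0)"
  shows "dir_deriv f P X = D"
proof -
  have "dir_deriv f P X = vector_derivative h (at 0)"
    unfolding dir_deriv_def by (rule vector_derivative_cong_eq) (use assms in auto)
  then show ?thesis using assms(2) vector_derivative_at by metis
qed

text \<open>
  The domain may have empty interior in the ambient space, so only the derivative relative to \<open>M\<close>
  is given. Its restriction to a segment through \<open>P\<close> along \<open>V\<close> is an ordinary one-variable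
  derivative, because the segment stays in \<open>M\<close> near \<open>P\<close>.
\<close>

lemma dir_deriv_linear:
  assumes M: "subspace V" "openin (top_of_set V) M" "P \<in> M" and f: "Ck_on V M (Suc 0) f"
  obtains L where "linear L" "\<And>X. X \<in> V \<Longrightarrow> dir_deriv f P X = L X"
proof -
  obtain f' where f': "\<And>P. P \<in> M \<Longrightarrow> (f has_derivative f' P) (at P within M)"
    using f by auto
  have "linear (f' P)" using f'[OF M(3)] has_derivative_linear by blast
  moreover have "dir_deriv f P X = f' P X" if X: "X \<in> V" for X
  proof -
    obtain S where S: "open S" "0 \<in> S" "\<And>t. t \<in> S \<Longrightarrow> P + t *\<^sub>R X \<in> M"
      using eventually_line_in_openin[OF M X] unfolding eventually_nhds by blast
    have "((\<lambda>t. P + t *\<^sub>R X) has_derivative (\<lambda>t. t *\<^sub>R X)) (at 0 within S)"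
      by (auto intro!: derivative_eq_intros)
    moreover have "(f has_derivative f' P) (at (P + 0 *\<^sub>R X) within (\<lambda>t. P + t *\<^sub>R X) ` S)"
      using has_derivative_subset[OF f'[OF M(3)], of "(\<lambda>t. P + t *\<^sub>R X) ` S"] S(3) by auto
    ultimately have "((\<lambda>t. f (P + t *\<^sub>R X)) has_derivative (\<lambda>t. f' P (t *\<^sub>R X))) (at 0 within S)"
      by (rule has_derivative_in_compose)
    then have "((\<lambda>t. f (P + t *\<^sub>R X)) has_vector_derivative f' P X) (at 0)"
      unfolding has_vector_derivative_def at_within_open[OF S(2,1)]
        linear_scale[OF \<open>linear (f' P)\<close>] .
    then show ?thesis by (intro dir_deriv_eqI[of f P X "\<lambda>t. f (P + t *\<^sub>R X)"]) auto
  qed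
  ultimately show ?thesis using that by blast
qed

lemma Ck_on_subset:
  assumes "Ck_on V M k f" "W \<subseteq> V" "F \<subseteq> M"
  shows "Ck_on W F k f"
  using assms(1)
proof (induction k arbitrary: f)
  case 0
  then show ?case using assms(3) continuous_on_subset by auto
next
  case (Suc k)
  then obtain f' where f': "\<And>P. P \<in> M \<Longrightarrow> (f has_derivative f' P) (at P within M)"
    "\<And>X. X \<in> V \<Longrightarrow> Ck_on V M k (\<lambda>P. f' P X)" by auto
  show ?case
    unfolding Ck_on.simps
  proof (intro exI[of _ f'] conjI ballI)
    show "(f has_derivative f' P) (at P within F)" if "P \<in> F" for P
      using f'(1) that assms(3) has_derivative_subset by blast
    show "Ck_on W F k (\<lambda>P. f' P X)" if "X \<in> W" for X
      using that assms(2) by (intro Suc.IH f'(2)) auto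
  qed
qed

lemma metric_symmetric:
  assumes "riemannian_domain V M g" "P \<in> M" "X \<in> V" "Y \<in> V"
  shows "g P X Y = g P Y X"
  using assms unfolding riemannian_domain_def by blast

lemma metric_positive:
  assumes "riemannian_domain V M g" "P \<in> M" "X \<in> V" "X \<noteq> 0"
  shows "0 < g P X X"
  using assms unfolding riemannian_domain_def by blast

lemma metric_Ck_on:
  assumes "riemannian_domain V M g" "X \<in> V" "Y \<in> V"
  shows "Ck_on V M k (\<lambda>P. g P X Y)"
  using assms unfolding riemannian_domain_def by blast

lemma metric_bilinear:
  assumes "riemannian_domain V M g" "P \<in> M"
  shows "X \<in> V \<Longrightarrow> Y \<in> V \<Longrightarrow> Z \<in> V \<Longrightarrow> g P (X + Y) Z = g P X Z + g P Y Z"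
    and "X \<in> V \<Longrightarrow> Y \<in> V \<Longrightarrow> g P (r *\<^sub>R X) Y = r * g P X Y"
    and "X \<in> V \<Longrightarrow> Y \<in> V \<Longrightarrow> Z \<in> V \<Longrightarrow> g P X (Y + Z) = g P X Y + g P X Z"
    and "X \<in> V \<Longrightarrow> Y \<in> V \<Longrightarrow> g P X (r *\<^sub>R Y) = r * g P X Y"
proof -
  note dom = assms(1)[unfolded riemannian_domain_def]
  have V: "subspace V" using dom by blast
  note sym = metric_symmetric[OF assms]
  show a: "X \<in> V \<Longrightarrow> Y \<in> V \<Longrightarrow> Z \<in> V \<Longrightarrow> g P (X + Y) Z = g P X Z + g P Y Z" for X Y Z
    using dom assms(2) by blast
  show s: "X \<in> V \<Longrightarrow> Y \<in> V \<Longrightarrow> g P (r *\<^sub>R X) Y = r * g P X Y" for X Y r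
    using dom assms(2) by blast
  show "X \<in> V \<Longrightarrow> Y \<in> V \<Longrightarrow> Z \<in> V \<Longrightarrow> g P X (Y + Z) = g P X Y + g P X Z"
    using a[of Y Z X] sym[of X "Y + Z"] sym[of X Y] sym[of X Z] subspace_add[OF V] by simp
  show "X \<in> V \<Longrightarrow> Y \<in> V \<Longrightarrow> g P X (r *\<^sub>R Y) = r * g P X Y"
    using s[of Y X r] sym[of X "r *\<^sub>R Y"] sym[of X Y] subspace_scale[OF V] by simp
qed

lemma riemannian_domain_subset:
  assumes M: "riemannian_domain V M g"
    and "subspace W" "openin (top_of_set W) F" "F \<noteq> {}" "W \<subseteq> V" "F \<subseteq> M"
  shows "riemannian_domain W F g"
proof -
  have "Ck_on W F k (\<lambda>P. g P X Y)" if "X \<in> W" "Y \<in> W" for k X Y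
    using that assms(5,6) by (intro Ck_on_subset[OF metric_Ck_on[OF M]]) auto
  moreover have "g P X Y = g P Y X" if "P \<in> F" "X \<in> W" "Y \<in> W" for P X Y
    using that assms(5,6) by (intro metric_symmetric[OF M]) auto
  moreover have "g P (X + Y) Z = g P X Z + g P Y Z"
    if "P \<in> F" "X \<in> W" "Y \<in> W" "Z \<in> W" for P X Y Z
    using that assms(5,6) by (intro metric_bilinear[OF M]) auto
  moreover have "g P (r *\<^sub>R X) Y = r * g P X Y" if "P \<in> F" "X \<in> W" "Y \<in> W" for P r X Y
    using that assms(5,6) by (intro metric_bilinear[OF M]) auto
  moreover have "0 < g P X X" if "P \<in> F" "X \<in> W" "X \<noteq> 0" for P X
    using that assms(5,6) by (intro metric_positive[OF M]) auto
  ultimately show ?thesis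
    using assms(2-4) unfolding riemannian_domain_def by simp
qed

text \<open>
  The component \<open>z\<close> of the velocity orthogonal to \<open>V\<close> is zero: \<open>z \<bullet> z\<close> is the derivative of the
  function \<open>s \<mapsto> \<gamma> s \<bullet> z\<close>, which vanishes on \<open>I\<close>.
\<close>

lemma has_vector_derivative_in_subspace:
  fixes \<gamma> :: "real \<Rightarrow> 'a::euclidean_space"
  assumes V: "subspace V" and I: "open I" "t \<in> I" "\<And>s. s \<in> I \<Longrightarrow> \<gamma> s \<in> V"
    and d: "(\<gamma> has_vector_derivative v) (at t)"
  shows "v \<in> V"
proof -
  obtain y z where yz: "y \<in> span V" "\<And>w. w \<in> span V \<Longrightarrow> orthogonal z w" "v = y + z"
    using orthogonal_subspace_decomp_exists by blast
  have V': "span V = V" using V by (simp add: span_eq_iff)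
  have "((\<lambda>s. \<gamma> s \<bullet> z) has_vector_derivative v \<bullet> z) (at t)"
    by (rule bounded_linear.has_vector_derivative[OF bounded_linear_inner_left d])
  moreover have "((\<lambda>s. \<gamma> s \<bullet> z) has_vector_derivative 0) (at t)"
  proof (rule has_vector_derivative_transform_within_open[of "\<lambda>_. 0"])
    show "0 = \<gamma> s \<bullet> z" if "s \<in> I" for s
      using yz(2)[of "\<gamma> s"] I(3)[OF that] by (simp add: V' orthogonal_def inner_commute[of _ z])
  qed (use I in simp_all)
  ultimately have "v \<bullet> z = 0" by (rule vector_derivative_unique_at)
  moreover have "y \<bullet> z = 0" using yz(2)[OF yz(1)] by (simp add: orthogonal_def inner_commute[of _ z])
  ultimately have "z = 0" using yz(3) by (simp add: inner_add_left)
  then show ?thesis using yz V' by simp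
qed

text \<open>
  A positive definite form determines a vector by its products with all test vectors, so any
  solution of the Koszul formula is the Christoffel vector. Below, solutions are exhibited
  explicitly, which also settles existence.
\<close>

lemma christoffel_eqI:
  assumes M: "riemannian_domain V M g" "P \<in> M" and W: "W \<in> V"
    and koszul: "\<And>Z. Z \<in> V \<Longrightarrow> 2 * g P W Z = dir_deriv (\<lambda>R. g R Y Z) P X
      + dir_deriv (\<lambda>R. g R X Z) P Y - dir_deriv (\<lambda>R. g R X Y) P Z"
  shows "christoffel V g P X Y = W"
  unfolding christoffel_def
proof (rule the_equality)
  show "W \<in> V \<and> (\<forall>Z\<in>V. 2 * g P W Z = dir_deriv (\<lambda>R. g R Y Z) P X
      + dir_deriv (\<lambda>R. g R X Z) P Y - dir_deriv (\<lambda>R. g R X Y) P Z)"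
    using W koszul by blast
next
  fix U
  assume U: "U \<in> V \<and> (\<forall>Z\<in>V. 2 * g P U Z = dir_deriv (\<lambda>R. g R Y Z) P X
      + dir_deriv (\<lambda>R. g R X Z) P Y - dir_deriv (\<lambda>R. g R X Y) P Z)"
  have V: "subspace V" using M(1) by (simp add: riemannian_domain_def)
  have D: "U - W \<in> V" using V U W by (simp add: subspace_diff)
  have "g P U (U - W) = g P W (U - W)" using koszul[OF D] bspec[OF conjunct2[OF U] D] by simp
  then have "g P (U - W) (U - W) = 0" using metric_bilinear(1)[OF M D W D] by simp
  then show "U = W" using metric_positive[OF M D] by force
qed

section \<open>Functionals invariant under sign changes\<close>

text \<open>
  For \<open>S = UNIV\<close> this is the diagonal part. The intermediate sets make it reachable one index at a
  time.
\<close>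

definition clear_off_diagonal ::
  "'n set \<Rightarrow> 'k::real_or_complex^'n^'n \<Rightarrow> 'k^'n^'n" where
  "clear_off_diagonal S Z = (\<chi> i j. if i \<noteq> j \<and> (i \<in> S \<or> j \<in> S) then 0 else Z $ i $ j)"

lemma ctranspose_nth: "ctranspose A $ i $ j = kcnj (A $ j $ i)"
  by (simp add: ctranspose_def)

lemma herm_iff: "A \<in> herm \<longleftrightarrow> (\<forall>i j. kcnj (A $ j $ i) = A $ i $ j)"
  by (simp add: herm_def vec_eq_iff ctranspose_nth)

lemma clear_off_diagonal_herm: "Z \<in> herm \<Longrightarrow> clear_off_diagonal S Z \<in> herm"
  by (auto simp: herm_iff clear_off_diagonal_def kcnj_0)

lemma congruence_rdiag_herm: "Z \<in> herm \<Longrightarrow> congruence (rdiag a) Z \<in> herm"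
  unfolding herm_iff congruence_rdiag_nth by (auto simp: kcnj_scaleR mult.commute)

text \<open>
  Averaging over the change of the \<open>k\<close>-th sign cancels the entries with exactly one index equal
  to \<open>k\<close>.
\<close>

lemma clear_off_diagonal_insert:
  fixes Z :: "'k::real_or_complex^'n^'n"
  shows "clear_off_diagonal (insert k S) Z
    = (1/2) *\<^sub>R (clear_off_diagonal S Z
        + congruence (rdiag (\<lambda>i. if i = k then - 1 else 1)) (clear_off_diagonal S Z))"
    (is "?A = ?B")
proof -
  have "?A $ i $ j = ?B $ i $ j" for i j
    unfolding vector_scaleR_component vector_add_component congruence_rdiag_nth
    by (auto simp: clear_off_diagonal_def simp flip: scaleR_left_distrib)
  then show ?thesis by (simp add: vec_eq_iff)
qed

lemma clear_off_diagonal_UNIV_diag_herm: "Z \<in> herm \<Longrightarrow> clear_off_diagonal UNIV Z \<in> diag_herm"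
  unfolding diag_herm_def by (simp add: clear_off_diagonal_herm) (simp add: diagonal_mat_def clear_off_diagonal_def)

text \<open>
  The diagonal part of \<open>Z\<close> arises from \<open>Z\<close> by averaging over one sign after the other, and no
  averaging step changes the value of an invariant linear functional.
\<close>

lemma sign_invariant_functional:
  fixes \<phi> :: "'k::real_or_complex^'n^'n \<Rightarrow> real"
  assumes add: "\<And>Z W. Z \<in> herm \<Longrightarrow> W \<in> herm \<Longrightarrow> \<phi> (Z + W) = \<phi> Z + \<phi> W"
    and scale: "\<And>r Z. Z \<in> herm \<Longrightarrow> \<phi> (r *\<^sub>R Z) = r * \<phi> Z"
    and inv: "\<And>s Z. (\<And>i. (s i)\<^sup>2 = 1) \<Longrightarrow> Z \<in> herm \<Longrightarrow> \<phi> (congruence (rdiag s) Z) = \<phi> Z"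
    and Z: "Z \<in> herm"
  shows "\<phi> (clear_off_diagonal UNIV Z) = \<phi> Z"
proof -
  have "\<phi> (clear_off_diagonal S Z) = \<phi> Z" if "finite S" for S
    using that
  proof induction
    case empty
    have "clear_off_diagonal {} Z = Z" by (simp add: clear_off_diagonal_def vec_eq_iff)
    then show ?case by simp
  next
    case (insert k S)
    let ?Y = "clear_off_diagonal S Z"
    let ?Y' = "congruence (rdiag (\<lambda>i. if i = k then - 1 else 1)) ?Y"
    have Y: "?Y \<in> herm" "?Y' \<in> herm" by (simp_all add: Z clear_off_diagonal_herm congruence_rdiag_herm)
    have "\<phi> ?Y' = \<phi> ?Y" by (rule inv) (simp_all add: Y)
    moreover have "?Y + ?Y' \<in> herm" using Y subspace_herm subspace_add by blast
    ultimately show ?case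
      unfolding clear_off_diagonal_insert using Y insert.IH by (simp add: scale add)
  qed
  then show ?thesis by simp
qed

section \<open>Invariant metrics at diagonal matrices\<close>

lemma invariant_metric_congruence_rdiag:
  fixes g :: "'k::real_or_complex^'n^'n \<Rightarrow> 'k^'n^'n \<Rightarrow> 'k^'n^'n \<Rightarrow> real"
  assumes "invariant_metric g" "\<And>i. a i \<noteq> 0" "P \<in> pos_cone" "X \<in> herm" "Y \<in> herm"
  shows "g (congruence (rdiag a) P) (congruence (rdiag a) X) (congruence (rdiag a) Y) = g P X Y"
proof -
  have "invertible (rdiag a :: 'k^'n^'n)" using assms(2) by (rule invertible_rdiag)
  then show ?thesis using assms(1,3-5) by (simp add: invariant_metric_def)
qed

lemma rdiag_herm: "rdiag x \<in> herm"
  by (auto simp: herm_iff rdiag_nth kcnj_of_real kcnj_0)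

text \<open>
  Sign changes fix \<open>rdiag p\<close> and \<open>rdiag y\<close>, so the functional \<open>g (rdiag p) (rdiag y)\<close> is invariant
  under them; in particular diagonal and off-diagonal directions are orthogonal.
\<close>

lemma metric_diag_part:
  fixes g :: "'k::real_or_complex^'n^'n \<Rightarrow> 'k^'n^'n \<Rightarrow> 'k^'n^'n \<Rightarrow> real"
  assumes g: "invariant_metric g" and p: "\<And>i. 0 < p i" and Z: "Z \<in> herm"
  shows "g (rdiag p) (rdiag y) (clear_off_diagonal UNIV Z) = g (rdiag p) (rdiag y) Z"
proof (rule sign_invariant_functional[where \<phi> = "g (rdiag p) (rdiag y)", OF _ _ _ Z])
  have dom: "riemannian_domain herm pos_cone g" using g by (simp add: invariant_metric_def)
  have P: "(rdiag p :: 'k^'n^'n) \<in> pos_cone" using p by (simp add: rdiag_in_pos_cone_iff)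
  show "g (rdiag p) (rdiag y) (Z + W) = g (rdiag p) (rdiag y) Z + g (rdiag p) (rdiag y) W"
    if "Z \<in> herm" "W \<in> herm" for Z W
    using that by (intro metric_bilinear[OF dom P] rdiag_herm)
  show "g (rdiag p) (rdiag y) (r *\<^sub>R Z) = r * g (rdiag p) (rdiag y) Z" if "Z \<in> herm" for r Z
    using that by (intro metric_bilinear[OF dom P] rdiag_herm)
  show "g (rdiag p) (rdiag y) (congruence (rdiag s) Z) = g (rdiag p) (rdiag y) Z"
    if s: "\<And>i. (s i)\<^sup>2 = 1" and "Z \<in> herm" for s Z
  proof -
    have "s i \<noteq> 0" for i using s[of i] by auto
    then show ?thesis
      using invariant_metric_congruence_rdiag[where a = s, OF g _ P rdiag_herm[of y] \<open>Z \<in> herm\<close>]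
      by (simp add: congruence_rdiag s)
  qed
qed

text \<open>
  For the same reason the derivative of \<open>R \<mapsto> g R (rdiag x) (rdiag y)\<close> at a diagonal point is a
  sign-invariant functional of the direction. Smoothness of the metric enters here, as it makes
  this functional linear.
\<close>

lemma metric_deriv_diag_part:
  fixes g :: "'k::real_or_complex^'n^'n \<Rightarrow> 'k^'n^'n \<Rightarrow> 'k^'n^'n \<Rightarrow> real"
  assumes g: "invariant_metric g" and p: "\<And>i. 0 < p i" and Z: "Z \<in> herm"
  shows "dir_deriv (\<lambda>R. g R (rdiag x) (rdiag y)) (rdiag p) (clear_off_diagonal UNIV Z)
    = dir_deriv (\<lambda>R. g R (rdiag x) (rdiag y)) (rdiag p) Z"
proof -
  let ?f = "\<lambda>R. g R (rdiag x) (rdiag y)"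
  have dom: "riemannian_domain herm pos_cone g" using g by (simp add: invariant_metric_def)
  have P: "(rdiag p :: 'k^'n^'n) \<in> pos_cone" using p by (simp add: rdiag_in_pos_cone_iff)
  have op: "openin (top_of_set herm) (pos_cone :: ('k^'n^'n) set)"
    using dom by (simp add: riemannian_domain_def)
  then obtain L where L: "linear L" "\<And>Z. Z \<in> herm \<Longrightarrow> dir_deriv ?f (rdiag p) Z = L Z"
    using dir_deriv_linear[OF subspace_herm op P metric_Ck_on[OF dom rdiag_herm rdiag_herm]]
    by blast
  have inv: "L (congruence (rdiag s) Z) = L Z"
    if s: "\<And>i. (s i)\<^sup>2 = 1" and Z: "Z \<in> herm" for s Z
  proof -
    have s0: "s i \<noteq> 0" for i using s[of i] by auto
    have "congruence (rdiag s) (rdiag p + t *\<^sub>R Z) = rdiag p + t *\<^sub>R congruence (rdiag s) Z" for t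
    proof -
      have "congruence (rdiag s) (rdiag p + t *\<^sub>R Z)
          = congruence (rdiag s) (rdiag p) + t *\<^sub>R congruence (rdiag s) Z"
        by (simp add: vec_eq_iff congruence_rdiag_nth scaleR_right_distrib mult.commute)
      then show ?thesis by (simp add: congruence_rdiag s)
    qed
    then have "?f (rdiag p + t *\<^sub>R congruence (rdiag s) Z) = ?f (rdiag p + t *\<^sub>R Z)"
      if "rdiag p + t *\<^sub>R Z \<in> pos_cone" for t
      using invariant_metric_congruence_rdiag[where a = s, OF g s0 that rdiag_herm[of x] rdiag_herm[of y]]
      by (simp add: congruence_rdiag s)
    then have "dir_deriv ?f (rdiag p) (congruence (rdiag s) Z) = dir_deriv ?f (rdiag p) Z"
      by (intro dir_deriv_cong
            eventually_mono[OF eventually_line_in_openin[OF subspace_herm op P Z]])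
    then show ?thesis using L(2) Z congruence_rdiag_herm by metis
  qed
  have "L (clear_off_diagonal UNIV Z) = L Z"
    by (rule sign_invariant_functional[where \<phi> = L, OF _ _ inv Z])
       (simp_all add: linear_add[OF L(1)] linear_scale[OF L(1)])
  then show ?thesis using L(2) Z clear_off_diagonal_herm by metis
qed

text \<open>
  Congruence by \<open>rdiag (1 / sqrt p)\<close> moves \<open>rdiag p\<close> to the identity and divides every diagonal
  tangent vector by \<open>p\<close>: in logarithmic coordinates the metric does not depend on the point.
\<close>

lemma metric_rdiag:
  fixes g :: "'k::real_or_complex^'n^'n \<Rightarrow> 'k^'n^'n \<Rightarrow> 'k^'n^'n \<Rightarrow> real"
  assumes g: "invariant_metric g" and p: "\<And>i. 0 < p i"
  shows "g (rdiag p) (rdiag x) (rdiag y)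
    = g (rdiag (\<lambda>_. 1)) (rdiag (\<lambda>i. x i / p i)) (rdiag (\<lambda>i. y i / p i))"
proof -
  define a where "a i = 1 / sqrt (p i)" for i
  have a0: "a i \<noteq> 0" and a2: "(a i)\<^sup>2 = 1 / p i" for i
    using p[of i] by (auto simp: a_def power_divide)
  have P: "(rdiag p :: 'k^'n^'n) \<in> pos_cone" using p by (simp add: rdiag_in_pos_cone_iff)
  have "p i \<noteq> 0" for i using p[of i] by simp
  then show ?thesis
    using invariant_metric_congruence_rdiag[where a = a, OF g a0 P rdiag_herm[of x] rdiag_herm[of y]]
    by (simp add: congruence_rdiag a2)
qed

definition diag_form :: "('k::real_or_complex^'n^'n \<Rightarrow> 'k^'n^'n \<Rightarrow> 'k^'n^'n \<Rightarrow> real)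
    \<Rightarrow> ('n \<Rightarrow> real) \<Rightarrow> ('n \<Rightarrow> real) \<Rightarrow> real" where
  "diag_form g x y = g (rdiag (\<lambda>_. 1)) (rdiag x) (rdiag y)"

text \<open>
  The coefficients are the products of the diagonal matrix units at the identity. The expansion
  turns derivatives of the metric into derivatives of finite sums of real quotients.
\<close>

lemma diag_form_sum:
  fixes g :: "'k::real_or_complex^'n^'n \<Rightarrow> 'k^'n^'n \<Rightarrow> 'k^'n^'n \<Rightarrow> real"
  assumes g: "invariant_metric g"
  obtains c where "\<And>x y. diag_form g x y = (\<Sum>i\<in>UNIV. \<Sum>j\<in>UNIV. c i j * x i * y j)"
proof
  fix x y :: "'n \<Rightarrow> real"
  have dom: "riemannian_domain herm pos_cone g" using g by (simp add: invariant_metric_def)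
  have P: "(rdiag (\<lambda>_. 1) :: 'k^'n^'n) \<in> pos_cone" using rdiag_in_pos_cone_iff by fastforce
  note bilinear = metric_bilinear[OF dom P]
  define e :: "'n \<Rightarrow> 'k^'n^'n" where "e i = rdiag (\<lambda>j. if j = i then 1 else 0)" for i
  have e: "e i \<in> herm" for i by (simp add: e_def rdiag_herm)
  have E: "rdiag x = (\<Sum>i\<in>UNIV. x i *\<^sub>R e i)" for x
    unfolding e_def by (rule rdiag_sum_units)
  have h: "(\<Sum>i\<in>S. x i *\<^sub>R e i) \<in> herm" for x and S
    using e by (intro subspace_sum subspace_herm subspace_scale) auto
  have sc: "r *\<^sub>R e i \<in> herm" for r i using e subspace_herm subspace_scale by blast
  have z: "g (rdiag (\<lambda>_. 1)) 0 Y = 0" "g (rdiag (\<lambda>_. 1)) Y 0 = 0" if "Y \<in> herm" for Y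
    using bilinear(2)[of Y Y 0] bilinear(4)[of Y Y 0] that by simp_all
  have 1: "g (rdiag (\<lambda>_. 1)) (\<Sum>i\<in>S. x i *\<^sub>R e i) Y = (\<Sum>i\<in>S. x i * g (rdiag (\<lambda>_. 1)) (e i) Y)"
    if "Y \<in> herm" "finite S" for S Y
    using that(2) by induction (simp_all add: z that(1) bilinear h e sc)
  have 2: "g (rdiag (\<lambda>_. 1)) Y (\<Sum>i\<in>S. y i *\<^sub>R e i) = (\<Sum>i\<in>S. y i * g (rdiag (\<lambda>_. 1)) Y (e i))"
    if "Y \<in> herm" "finite S" for S Y
    using that(2) by induction (simp_all add: z that(1) bilinear h e sc)
  show "diag_form g x y = (\<Sum>i\<in>UNIV. \<Sum>j\<in>UNIV. g (rdiag (\<lambda>_. 1)) (e i) (e j) * x i * y j)"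
    unfolding diag_form_def E[of x] E[of y]
    by (subst sum.swap) (simp add: 1 2 h e sum_distrib_left mult_ac)
qed

text \<open>
  The product rule for the form \<open>diag_form g (y / p) (z / p)\<close>, with \<open>1 / p\<close> differentiated in the
  direction \<open>x\<close> to \<open>- x / p\<^sup>2\<close>. It is carried out on the expansion in coefficients.
\<close>

lemma dir_deriv_metric_rdiag:
  fixes g :: "'k::real_or_complex^'n^'n \<Rightarrow> 'k^'n^'n \<Rightarrow> 'k^'n^'n \<Rightarrow> real"
  assumes g: "invariant_metric g" and p: "\<And>i. 0 < p i"
  shows "dir_deriv (\<lambda>R. g R (rdiag y) (rdiag z)) (rdiag p) (rdiag x)
    = - diag_form g (\<lambda>i. x i * y i / (p i)\<^sup>2) (\<lambda>i. z i / p i)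
      - diag_form g (\<lambda>i. y i / p i) (\<lambda>i. x i * z i / (p i)\<^sup>2)"
proof -
  obtain c where c: "\<And>x y. diag_form g x y = (\<Sum>i\<in>UNIV. \<Sum>j\<in>UNIV. c i j * x i * y j)"
    using diag_form_sum[OF g] by blast
  have op: "openin (top_of_set herm) (pos_cone :: ('k^'n^'n) set)"
    using g by (simp add: invariant_metric_def riemannian_domain_def)
  have P: "(rdiag p :: 'k^'n^'n) \<in> pos_cone" using p by (simp add: rdiag_in_pos_cone_iff)
  have p0: "p i \<noteq> 0" for i using p[of i] by simp
  have "\<forall>\<^sub>F t in nhds 0. g (rdiag p + t *\<^sub>R rdiag x) (rdiag y) (rdiag z)
      = (\<Sum>i\<in>UNIV. \<Sum>j\<in>UNIV. c i j * (y i / (p i + t * x i)) * (z j / (p j + t * x j)))"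
    using eventually_line_in_openin[OF subspace_herm op P rdiag_herm[of x]]
  proof eventually_elim
    case (elim t)
    then have "0 < p i + t * x i" for i
      by (simp add: rdiag_scaleR rdiag_add rdiag_in_pos_cone_iff)
    then show ?case
      by (simp add: rdiag_scaleR rdiag_add metric_rdiag[OF g] c flip: diag_form_def)
  qed
  moreover have "((\<lambda>t. \<Sum>i\<in>UNIV. \<Sum>j\<in>UNIV. c i j * (y i / (p i + t * x i)) * (z j / (p j + t * x j)))
      has_vector_derivative (\<Sum>i\<in>UNIV. \<Sum>j\<in>UNIV.
        - (c i j * (x i * y i / (p i)\<^sup>2) * (z j / p j))
        - c i j * (y i / p i) * (x j * z j / (p j)\<^sup>2))) (at 0)"
    unfolding has_real_derivative_iff_has_vector_derivative[symmetric]
  proof (intro DERIV_sum)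
    fix i j
    show "((\<lambda>t. c i j * (y i / (p i + t * x i)) * (z j / (p j + t * x j))) has_real_derivative
        - (c i j * (x i * y i / (p i)\<^sup>2) * (z j / p j))
        - c i j * (y i / p i) * (x j * z j / (p j)\<^sup>2)) (at 0)"
      by (rule derivative_eq_intros refl | simp add: p0)+ (simp add: power2_eq_square mult_ac)
  qed
  ultimately have "dir_deriv (\<lambda>R. g R (rdiag y) (rdiag z)) (rdiag p) (rdiag x)
      = (\<Sum>i\<in>UNIV. \<Sum>j\<in>UNIV.
        - (c i j * (x i * y i / (p i)\<^sup>2) * (z j / p j))
        - c i j * (y i / p i) * (x j * z j / (p j)\<^sup>2))"
    by (rule dir_deriv_eqI)
  then show ?thesis by (simp add: c sum_subtractf sum_negf)
qed

text \<open>
  For diagonal \<open>Z\<close> the three derivatives contribute six terms. The four in which \<open>z\<close> is multiplied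
  by \<open>x\<close> or \<open>y\<close> cancel by symmetry of the form and the other two add up to the left-hand side.
  A general \<open>Z\<close> can be replaced by its diagonal part in every term.
\<close>

lemma koszul_rdiag:
  fixes g :: "'k::real_or_complex^'n^'n \<Rightarrow> 'k^'n^'n \<Rightarrow> 'k^'n^'n \<Rightarrow> real"
  assumes g: "invariant_metric g" and p: "\<And>i. 0 < p i" and Z: "Z \<in> herm"
  shows "2 * g (rdiag p) (rdiag (\<lambda>i. - (x i * y i / p i))) Z
    = dir_deriv (\<lambda>R. g R (rdiag y) Z) (rdiag p) (rdiag x)
      + dir_deriv (\<lambda>R. g R (rdiag x) Z) (rdiag p) (rdiag y)
      - dir_deriv (\<lambda>R. g R (rdiag x) (rdiag y)) (rdiag p) Z"
proof -
  have dom: "riemannian_domain herm pos_cone g" using g by (simp add: invariant_metric_def)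
  have op: "openin (top_of_set herm) (pos_cone :: ('k^'n^'n) set)"
    using dom by (simp add: riemannian_domain_def)
  have P: "(rdiag p :: 'k^'n^'n) \<in> pos_cone" using p by (simp add: rdiag_in_pos_cone_iff)
  obtain z where z: "clear_off_diagonal UNIV Z = rdiag z"
    using clear_off_diagonal_UNIV_diag_herm[OF Z] unfolding diag_herm_eq by blast
  have "dir_deriv (\<lambda>R. g R (rdiag v) Z) (rdiag p) (rdiag u)
      = dir_deriv (\<lambda>R. g R (rdiag v) (rdiag z)) (rdiag p) (rdiag u)" for u v
  proof (rule dir_deriv_cong)
    show "\<forall>\<^sub>F t in nhds 0. g (rdiag p + t *\<^sub>R rdiag u) (rdiag v) Z
        = g (rdiag p + t *\<^sub>R rdiag u) (rdiag v) (rdiag z)"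
      using eventually_line_in_openin[OF subspace_herm op P rdiag_herm[of u]]
    proof eventually_elim
      case (elim t)
      then have "0 < p i + t * u i" for i
        by (simp add: rdiag_scaleR rdiag_add rdiag_in_pos_cone_iff)
      then show ?case
        using metric_diag_part[OF g _ Z] by (simp add: rdiag_scaleR rdiag_add z)
    qed
  qed
  moreover have "g (rdiag p) (rdiag u) Z = g (rdiag p) (rdiag u) (rdiag z)" for u
    using metric_diag_part[OF g p Z] by (simp add: z)
  moreover have "dir_deriv (\<lambda>R. g R (rdiag x) (rdiag y)) (rdiag p) Z
      = dir_deriv (\<lambda>R. g R (rdiag x) (rdiag y)) (rdiag p) (rdiag z)"
    using metric_deriv_diag_part[OF g p Z] by (simp add: z)
  moreover have "diag_form g u v = diag_form g v u" for u v
  proof -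
    have "(rdiag (\<lambda>_. 1) :: 'k^'n^'n) \<in> pos_cone" using rdiag_in_pos_cone_iff by fastforce
    then show ?thesis
      unfolding diag_form_def by (intro metric_symmetric[OF dom] rdiag_herm)
  qed
  moreover have "g (rdiag p) (rdiag (\<lambda>i. - (x i * y i / p i))) (rdiag z)
      = - diag_form g (\<lambda>i. x i * y i / (p i)\<^sup>2) (\<lambda>i. z i / p i)"
  proof -
    obtain c where "\<And>x y. diag_form g x y = (\<Sum>i\<in>UNIV. \<Sum>j\<in>UNIV. c i j * x i * y j)"
      using diag_form_sum[OF g] by blast
    then show ?thesis
      unfolding metric_rdiag[OF g p] diag_form_def[symmetric]
      by (simp add: power2_eq_square sum_negf)
  qed
  ultimately show ?thesis
    by (simp add: dir_deriv_metric_rdiag[OF g p] mult.commute)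
qed

section \<open>Flatness and total geodesy of the diagonal cone\<close>

lemma diag_cone_openin:
  assumes "openin (top_of_set herm) (pos_cone :: ('k::real_or_complex^'n^'n) set)"
  shows "openin (top_of_set diag_herm) (diag_cone :: ('k^'n^'n) set)"
proof -
  obtain T :: "('k^'n^'n) set" where "open T" "pos_cone = herm \<inter> T"
    using assms openin_open by blast
  then show ?thesis
    unfolding openin_open diag_cone_eq_Int diag_herm_def by blast
qed

lemma subspace_diag_herm: "subspace (diag_herm :: ('k::real_or_complex^'n^'n) set)"
  unfolding diag_herm_eq subspace_def
proof (intro conjI)
  have "(0 :: 'k^'n^'n) = rdiag (\<lambda>_. 0)" by (simp add: vec_eq_iff rdiag_nth)
  then show "(0 :: 'k^'n^'n) \<in> range rdiag" by blast
qed (auto simp: rdiag_add rdiag_scaleR)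

lemma riemannian_domain_diag_cone:
  fixes g :: "'k::real_or_complex^'n^'n \<Rightarrow> 'k^'n^'n \<Rightarrow> 'k^'n^'n \<Rightarrow> real"
  assumes "invariant_metric g"
  shows "riemannian_domain diag_herm diag_cone g"
proof (rule riemannian_domain_subset)
  show dom: "riemannian_domain herm pos_cone g" using assms by (simp add: invariant_metric_def)
  then show "openin (top_of_set diag_herm) (diag_cone :: ('k^'n^'n) set)"
    by (intro diag_cone_openin) (simp add: riemannian_domain_def)
  have "rdiag (\<lambda>_. 1) \<in> (diag_cone :: ('k^'n^'n) set)" unfolding diag_cone_eq by (rule imageI) simp
  then show "(diag_cone :: ('k^'n^'n) set) \<noteq> {}" by blast
  show "diag_herm \<subseteq> (herm :: ('k^'n^'n) set)" "diag_cone \<subseteq> (pos_cone :: ('k^'n^'n) set)"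
    by (auto simp: diag_herm_def diag_cone_def)
qed (rule subspace_diag_herm)

text \<open>
  The same vector solves the Koszul formula for Hermitian and for diagonal test vectors. The
  agreement of the two Christoffel maps is the vanishing of the second fundamental form.
\<close>

lemma christoffel_rdiag:
  fixes g :: "'k::real_or_complex^'n^'n \<Rightarrow> 'k^'n^'n \<Rightarrow> 'k^'n^'n \<Rightarrow> real"
  assumes g: "invariant_metric g" and p: "\<And>i. 0 < p i"
  shows "christoffel herm g (rdiag p) (rdiag x) (rdiag y) = rdiag (\<lambda>i. - (x i * y i / p i))"
    and "christoffel diag_herm g (rdiag p) (rdiag x) (rdiag y) = rdiag (\<lambda>i. - (x i * y i / p i))"
proof -
  show "christoffel herm g (rdiag p) (rdiag x) (rdiag y) = rdiag (\<lambda>i. - (x i * y i / p i))"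
  proof (rule christoffel_eqI[OF _ _ rdiag_herm koszul_rdiag[OF g p]])
    show "riemannian_domain herm pos_cone g" using g by (simp add: invariant_metric_def)
    show "rdiag p \<in> pos_cone" using p by (simp add: rdiag_in_pos_cone_iff)
  qed
  show "christoffel diag_herm g (rdiag p) (rdiag x) (rdiag y) = rdiag (\<lambda>i. - (x i * y i / p i))"
  proof (rule christoffel_eqI[OF riemannian_domain_diag_cone[OF g] _ _ koszul_rdiag[OF g p]])
    show "rdiag p \<in> diag_cone" using p by (simp add: diag_cone_eq)
    show "rdiag (\<lambda>i. - (x i * y i / p i)) \<in> diag_herm" unfolding diag_herm_eq by blast
    show "Z \<in> herm" if "Z \<in> diag_herm" for Z :: "'k^'n^'n" using that by (simp add: diag_herm_def)
  qed
qed

text \<open>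
  The formula \<open>- y z / p\<close> is available at diagonal points of the cone only, but the segment
  through \<open>rdiag p\<close> in a diagonal direction stays among them for small \<open>t\<close>, so it can be
  differentiated.
\<close>

lemma dir_deriv_christoffel_rdiag:
  fixes g :: "'k::real_or_complex^'n^'n \<Rightarrow> 'k^'n^'n \<Rightarrow> 'k^'n^'n \<Rightarrow> real"
  assumes g: "invariant_metric g" and p: "\<And>i. 0 < p i"
  shows "dir_deriv (\<lambda>R. christoffel diag_herm g R (rdiag y) (rdiag z)) (rdiag p) (rdiag x)
    = rdiag (\<lambda>i. x i * y i * z i / (p i)\<^sup>2)"
proof (rule dir_deriv_eqI)
  have P: "(rdiag p :: 'k^'n^'n) \<in> pos_cone" using p by (simp add: rdiag_in_pos_cone_iff)
  have op: "openin (top_of_set herm) (pos_cone :: ('k^'n^'n) set)"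
    using g by (simp add: invariant_metric_def riemannian_domain_def)
  show "\<forall>\<^sub>F t in nhds 0. christoffel diag_herm g (rdiag p + t *\<^sub>R rdiag x) (rdiag y) (rdiag z)
      = rdiag (\<lambda>i. - (y i * z i / (p i + t * x i)))"
    using eventually_line_in_openin[OF subspace_herm op P rdiag_herm[of x]]
  proof eventually_elim
    case (elim t)
    then have "0 < p i + t * x i" for i
      by (simp add: rdiag_scaleR rdiag_add rdiag_in_pos_cone_iff)
    then show ?case
      by (simp add: rdiag_scaleR rdiag_add christoffel_rdiag[OF g])
  qed
  have p0: "p i \<noteq> 0" for i using p[of i] by simp
  (* Expanded in the diagonal matrix units, of which only the coefficients depend on t. *)
  show "((\<lambda>t. rdiag (\<lambda>i. - (y i * z i / (p i + t * x i)))) has_vector_derivative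
      (rdiag (\<lambda>i. x i * y i * z i / (p i)\<^sup>2) :: 'k^'n^'n)) (at 0)"
    unfolding rdiag_sum_units[of "\<lambda>i. - (y i * z i / (p i + _ * x i))"]
      rdiag_sum_units[of "\<lambda>i. x i * y i * z i / (p i)\<^sup>2"]
  proof (rule has_vector_derivative_sum)
    fix i
    let ?e = "rdiag (\<lambda>j. if j = i then 1 else 0) :: 'k^'n^'n"
    have d: "((\<lambda>t. - (y i * z i / (p i + t * x i))) has_real_derivative
        x i * y i * z i / (p i)\<^sup>2) (at 0)"
      by (rule derivative_eq_intros refl | simp add: p0)+ (simp add: power2_eq_square)
    show "((\<lambda>t. - (y i * z i / (p i + t * x i)) *\<^sub>R ?e) has_vector_derivative
        (x i * y i * z i / (p i)\<^sup>2) *\<^sub>R ?e) (at 0)"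
      using has_vector_derivative_scaleR[OF d has_vector_derivative_const[of ?e]] by simp
  qed
qed

text \<open>
  The derivative terms are both \<open>x y z / p\<^sup>2\<close>, and so are the quadratic ones.
\<close>

lemma curvature_rdiag:
  fixes g :: "'k::real_or_complex^'n^'n \<Rightarrow> 'k^'n^'n \<Rightarrow> 'k^'n^'n \<Rightarrow> real"
  assumes g: "invariant_metric g" and p: "\<And>i. 0 < p i"
  shows "curvature diag_herm g (rdiag p) (rdiag x) (rdiag y) (rdiag z) = 0"
  unfolding curvature_def dir_deriv_christoffel_rdiag[OF g p] christoffel_rdiag(2)[OF g p]
  by (simp add: mult_ac)

lemma flat_diag_cone:
  fixes g :: "'k::real_or_complex^'n^'n \<Rightarrow> 'k^'n^'n \<Rightarrow> 'k^'n^'n \<Rightarrow> real"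
  assumes g: "invariant_metric g"
  shows "flat diag_herm diag_cone g"
  unfolding flat_def
proof (intro ballI impI)
  fix P X Y :: "'k^'n^'n"
  assume "P \<in> diag_cone" "X \<in> diag_herm" "Y \<in> diag_herm"
  then obtain p x y where P: "P = rdiag p" "\<And>i. 0 < p i" and X: "X = rdiag x" and Y: "Y = rdiag y"
    unfolding diag_cone_eq diag_herm_eq by blast
  have dom: "riemannian_domain herm pos_cone g" using g by (simp add: invariant_metric_def)
  have "rdiag p \<in> (pos_cone :: ('k^'n^'n) set)" using P(2) by (simp add: rdiag_in_pos_cone_iff)
  from metric_bilinear(2)[OF dom this rdiag_herm rdiag_herm, of 0 x x]
  have "g (rdiag p) 0 (rdiag x) = 0" by simp
  then show "sectional_curvature diag_herm g P X Y = 0"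
    by (simp add: sectional_curvature_def P(1) X Y curvature_rdiag[OF g P(2)])
qed

text \<open>
  A curve in the diagonal cone has diagonal velocity, and there the two Christoffel maps agree, so
  the geodesic equations for the diagonal cone and for the whole cone are the same.
\<close>

lemma totally_geodesic_diag_cone:
  fixes g :: "'k::real_or_complex^'n^'n \<Rightarrow> 'k^'n^'n \<Rightarrow> 'k^'n^'n \<Rightarrow> real"
  assumes g: "invariant_metric g"
  shows "totally_geodesic herm pos_cone g diag_herm diag_cone"
  unfolding totally_geodesic_def
proof (intro conjI allI impI)
  show "riemannian_domain herm pos_cone g" using g by (simp add: invariant_metric_def)
  show "riemannian_domain diag_herm diag_cone g" by (rule riemannian_domain_diag_cone[OF g])
  show "diag_herm \<subseteq> (herm :: ('k^'n^'n) set)" and sub: "diag_cone \<subseteq> (pos_cone :: ('k^'n^'n) set)"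
    by (auto simp: diag_herm_def diag_cone_def)
  fix I and \<gamma> :: "real \<Rightarrow> 'k^'n^'n"
  assume "geodesic diag_herm diag_cone g I \<gamma>"
  then obtain \<gamma>' \<gamma>'' where I: "open I" "is_interval I"
    and \<gamma>: "\<And>t. t \<in> I \<Longrightarrow> \<gamma> t \<in> diag_cone"
      "\<And>t. t \<in> I \<Longrightarrow> (\<gamma> has_vector_derivative \<gamma>' t) (at t)"
      "\<And>t. t \<in> I \<Longrightarrow> (\<gamma>' has_vector_derivative \<gamma>'' t) (at t)"
      "\<And>t. t \<in> I \<Longrightarrow> \<gamma>'' t + christoffel diag_herm g (\<gamma> t) (\<gamma>' t) (\<gamma>' t) = 0"
    unfolding geodesic_def by blast
  have "christoffel diag_herm g (\<gamma> t) (\<gamma>' t) (\<gamma>' t) = christoffel herm g (\<gamma> t) (\<gamma>' t) (\<gamma>' t)"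
    if t: "t \<in> I" for t
  proof -
    have "\<gamma>' t \<in> diag_herm"
      using has_vector_derivative_in_subspace[OF subspace_diag_herm I(1) t _ \<gamma>(2)[OF t]] \<gamma>(1)
      by (auto simp: diag_cone_eq_Int)
    then obtain x where x: "\<gamma>' t = rdiag x" unfolding diag_herm_eq by blast
    obtain p where "\<gamma> t = rdiag p" "\<forall>i. 0 < p i" using \<gamma>(1)[OF t] unfolding diag_cone_eq by blast
    then show ?thesis by (simp add: x christoffel_rdiag[OF g])
  qed
  then show "geodesic herm pos_cone g I \<gamma>"
    unfolding geodesic_def using I \<gamma> sub by (intro conjI exI[of _ \<gamma>'] exI[of _ \<gamma>'']) auto
qed

lemma spectrahedron_interior_diagonal:
  assumes "diagonal_pencil Q0 Q"
  shows "spectrahedron_interior Q0 Q = {x. pencil Q0 Q x \<in> diag_cone}"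
  using assms
  by (auto simp: spectrahedron_interior_def diag_cone_def diagonal_pencil_def diagonal_mat_def pencil_def)

theorem proposition2:
  fixes g :: "'k::real_or_complex^'n^'n \<Rightarrow> 'k^'n^'n \<Rightarrow> 'k^'n^'n \<Rightarrow> real"
    and Q0 :: "'k^'n^'n" and Q :: "'m::finite \<Rightarrow> 'k^'n^'n"
  assumes "invariant_metric g"
    and "diagonal_pencil Q0 Q"
  shows "spectrahedron_interior Q0 Q = {x. pencil Q0 Q x \<in> diag_cone}
    \<and> totally_geodesic herm pos_cone g diag_herm diag_cone
    \<and> flat diag_herm diag_cone g
    \<and> cartan_subalgebra (a_tilde :: ('k^'n^'n) set)
    \<and> (diag_cone :: ('k^'n^'n) set) = (\<lambda>A. gl_quotient_map (matrix_exp A)) ` a_tilde"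
  unfolding a_tilde_eq
  using spectrahedron_interior_diagonal[OF assms(2)] totally_geodesic_diag_cone[OF assms(1)]
    flat_diag_cone[OF assms(1)] cartan_subalgebra_range_kdiag diag_cone_eq_exp
  by blast

end
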